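(* Let $j_1,j_2,j_3\in\{0,\tfrac12,1,\tfrac32,\dots\}$ satisfy $|j_1-j_2|\le j_3\le j_1+j_2$ and $j_1+j_2+j_3\in\mathbb{Z}$. Then the subspace of $SU(2)$-invariant vectors in $V_{j_1}\otimes V_{j_2}\otimes V_{j_3}$ is one-dimensional, spanned by the unit vector $$|\psi_3\rangle=\sum_{m_1,m_2,m_3}\begin{pmatrix} j_1&j_2&j_3\\ m_1&m_2&m_3\end{pmatrix}|j_1m_1\rangle|j_2m_2\rangle|j_3m_3\rangle,$$ and for each $k\in\{1,2,3\}$ the reduced density matrix of $|\psi_3\rangle\langle\psi_3|$ on $V_{j_k}$ (tracing out the other two factors) equals $\frac{1}{2j_k+1}\mathbb{I}$, so that its entanglement entropy is the maximal value $\ln(2j_k+1)$. In particular, for three qudits of equal spin $j_1=j_2=j_3=j$ and local dimension $d=2j+1$: if $d$ is odd, there is, up to a phase, a unique invariant perfect tensor in $V_j^{\otimes 3}$, given by $$\sum_{m_1,m_2,m_3=-j}^{j}\begin{pmatrix} j&j&j\\ m_1&m_2&m_3\end{pmatrix}|jm_1\rangle|jm_2\rangle|jm_3\rangle;$$ if $d$ is even, there is no nonzero invariant vector in $V_j^{\otimes 3}$.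
   Context: $V_j$ is the irreducible spin-$j$ representation of $SU(2)$ of dimension $2j+1$, with standard orthonormal weight basis $|jm\rangle$, $m=-j,-j+1,\dots,j$. The Wigner $3j$ symbol is $$\begin{pmatrix} j_1&j_2&j_3\\ m_1&m_2&m_3\end{pmatrix}=\frac{(-1)^{j_1-j_2-m_3}}{\sqrt{2j_3+1}}\langle j_1m_1;j_2m_2|j_3,-m_3\rangle,$$ where $\langle j_1m_1;j_2m_2|JM\rangle$ are the standard real (Condon–Shortley) Clebsch–Gordan coefficients. A vector in a tensor product of such representations is invariant if it is annihilated by the total angular momentum operators $\sum_i \mathbf{J}_i$ (equivalently, fixed by the diagonal $SU(2)$ action). A unit vector $|\psi\rangle\in V_j^{\otimes n}$ is perfect if for every subset of $k$ tensor factors, $1\le k\le\lfloor n/2\rfloor$, the reduced density matrix on these factors has maximal entropy, i.e. equals $d^{-k}\mathbb{I}_{d^k}$ with $d=2j+1$; for $n=3$ this means that all three one-particle reduced density matrices equal $\frac1d\mathbb{I}_d$. An invariant perfect tensor is a unit vector in $V_j^{\otimes n}$ that is both invariant and perfect. *)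

theory Defs
  imports
    "HOL-Analysis.Analysis"
    "HOL-Library.Function_Algebras"
    "Jordan_Normal_Form.Char_Poly"
begin

section \<open>Spin representations and their tensor products\<close>

definition spins :: "real set" where
  "spins = {j. 2 * j \<in> \<nat>}"

definition spin_dim :: "real \<Rightarrow> nat" where
  "spin_dim j = nat \<lfloor>2 * j + 1\<rfloor>"

definition weights :: "real \<Rightarrow> real list" where
  "weights j = map (\<lambda>k. real k - j) [0..<spin_dim j]"

text \<open>
  A list \<open>js\<close> of spins stands for the tensor product of the representations \<open>V_j\<close>, \<open>j\<close> in \<open>js\<close>.
  Its orthonormal product basis \<open>|j_1 m_1> ... |j_n m_n>\<close> is indexed by the lists
  \<open>[m_1, ..., m_n]\<close> of weights (enumerated lexicographically), and a vector is given by its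
  coordinates in this basis, extended by zero to all other lists.
\<close>

definition basis :: "real list \<Rightarrow> real list list" where
  "basis js = product_lists (map weights js)"

type_synonym state = "real list \<Rightarrow> complex"

definition tensor_space :: "real list \<Rightarrow> state set" where
  "tensor_space js = {\<psi>. \<forall>ms. ms \<notin> set (basis js) \<longrightarrow> \<psi> ms = 0}"

definition ket :: "real list \<Rightarrow> state" where
  "ket ms = (\<lambda>ms'. of_bool (ms' = ms))"

definition cscale :: "complex \<Rightarrow> state \<Rightarrow> state" where
  "cscale c \<psi> = (\<lambda>ms. c * \<psi> ms)"

text \<open>Addition of states is the pointwise one of \<^theory>\<open>HOL-Library.Function_Algebras\<close>.\<close>

lemma vector_space_cscale: "vector_space cscale"
  by unfold_locales (auto simp: cscale_def fun_eq_iff algebra_simps)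

definition unit_vector :: "real list \<Rightarrow> state \<Rightarrow> bool" where
  "unit_vector js \<psi> \<longleftrightarrow> \<psi> \<in> tensor_space js \<and> (\<Sum>ms\<in>set (basis js). (cmod (\<psi> ms))\<^sup>2) = 1"


section \<open>Angular momentum operators and invariant vectors\<close>

text \<open>\<open>spin_A j m' m\<close> is the matrix element \<open><j m'| J_A |j m>\<close> (with hbar = 1).\<close>

definition spin_plus :: "real \<Rightarrow> real \<Rightarrow> real \<Rightarrow> complex" where
  "spin_plus j m' m = (if m' = m + 1 then of_real (sqrt (j * (j + 1) - m * (m + 1))) else 0)"

definition spin_minus :: "real \<Rightarrow> real \<Rightarrow> real \<Rightarrow> complex" where
  "spin_minus j m' m = (if m' = m - 1 then of_real (sqrt (j * (j + 1) - m * (m - 1))) else 0)"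

definition spin_x :: "real \<Rightarrow> real \<Rightarrow> real \<Rightarrow> complex" where
  "spin_x j m' m = (spin_plus j m' m + spin_minus j m' m) / 2"

definition spin_y :: "real \<Rightarrow> real \<Rightarrow> real \<Rightarrow> complex" where
  "spin_y j m' m = (spin_plus j m' m - spin_minus j m' m) / (2 * \<i>)"

definition spin_z :: "real \<Rightarrow> real \<Rightarrow> real \<Rightarrow> complex" where
  "spin_z j m' m = (if m' = m then of_real m else 0)"

text \<open>The one-particle operator \<open>A\<close> acting on the \<open>i\<close>-th tensor factor (counted from 0).\<close>

definition site_op ::
  "(real \<Rightarrow> real \<Rightarrow> real \<Rightarrow> complex) \<Rightarrow> real list \<Rightarrow> nat \<Rightarrow> state \<Rightarrow> state" where
  "site_op A js i \<psi> = (\<lambda>ms. if ms \<in> set (basis js)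
     then \<Sum>m\<in>set (weights (js ! i)). A (js ! i) (ms ! i) m * \<psi> (ms[i := m]) else 0)"

definition total_op ::
  "(real \<Rightarrow> real \<Rightarrow> real \<Rightarrow> complex) \<Rightarrow> real list \<Rightarrow> state \<Rightarrow> state" where
  "total_op A js \<psi> = (\<lambda>ms. \<Sum>i<length js. site_op A js i \<psi> ms)"

definition invariant_space :: "real list \<Rightarrow> state set" where
  "invariant_space js =
     {\<psi> \<in> tensor_space js. \<forall>A\<in>{spin_x, spin_y, spin_z}. total_op A js \<psi> = 0}"


section \<open>Clebsch-Gordan coefficients and the Wigner 3j symbol\<close>

definition triad :: "real \<Rightarrow> real \<Rightarrow> real \<Rightarrow> bool" where
  "triad j1 j2 j3 \<longleftrightarrow> j1 \<in> spins \<and> j2 \<in> spins \<and> j3 \<in> spins \<and>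
     \<bar>j1 - j2\<bar> \<le> j3 \<and> j3 \<le> j1 + j2 \<and> j1 + j2 + j3 \<in> \<int>"

text \<open>
  \<open>\<Phi> M\<close> is the coupled state \<open>|J M>\<close> in the tensor product of \<open>V_j1\<close> and \<open>V_j2\<close>: the total angular
  momentum acts on these unit vectors as on the standard basis of \<open>V_J\<close>, and the remaining
  overall phase is fixed by the Condon-Shortley convention \<open><j1 j1; j2 (J-j1) | J J> > 0\<close>.
\<close>

definition coupled_basis :: "real \<Rightarrow> real \<Rightarrow> real \<Rightarrow> (real \<Rightarrow> state) \<Rightarrow> bool" where
  "coupled_basis j1 j2 J \<Phi> \<longleftrightarrow>
     (\<forall>M. M \<notin> set (weights J) \<longrightarrow> \<Phi> M = 0) \<and>
     (\<forall>M\<in>set (weights J).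
        unit_vector [j1, j2] (\<Phi> M) \<and>
        total_op spin_z [j1, j2] (\<Phi> M) = cscale (of_real M) (\<Phi> M) \<and>
        total_op spin_plus [j1, j2] (\<Phi> M) =
          cscale (of_real (sqrt (J * (J + 1) - M * (M + 1)))) (\<Phi> (M + 1)) \<and>
        total_op spin_minus [j1, j2] (\<Phi> M) =
          cscale (of_real (sqrt (J * (J + 1) - M * (M - 1)))) (\<Phi> (M - 1))) \<and>
     \<Phi> J [j1, J - j1] \<in> \<real> \<and> Re (\<Phi> J [j1, J - j1]) > 0"

text \<open>
  For a triad there is exactly one coupled basis, and all its coordinates are real, so that
  \<^const>\<open>Re\<close> below only changes the type.
\<close>

definition clebsch_gordan :: "real \<Rightarrow> real \<Rightarrow> real \<Rightarrow> real \<Rightarrow> real \<Rightarrow> real \<Rightarrow> real" where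
  "clebsch_gordan j1 m1 j2 m2 J M =
     (if triad j1 j2 J then Re ((THE \<Phi>. coupled_basis j1 j2 J \<Phi>) M [m1, m2]) else 0)"

text \<open>The exponent \<open>j1 - j2 - m3\<close> is an integer whenever the coefficient is that of a triad.\<close>

definition wigner_3j :: "real \<Rightarrow> real \<Rightarrow> real \<Rightarrow> real \<Rightarrow> real \<Rightarrow> real \<Rightarrow> real" where
  "wigner_3j j1 j2 j3 m1 m2 m3 =
     (-1) powi \<lfloor>j1 - j2 - m3\<rfloor> / sqrt (2 * j3 + 1) * clebsch_gordan j1 m1 j2 m2 j3 (- m3)"

definition three_j_state :: "real \<Rightarrow> real \<Rightarrow> real \<Rightarrow> state" where
  "three_j_state j1 j2 j3 =
     (\<Sum>m1\<in>set (weights j1). \<Sum>m2\<in>set (weights j2). \<Sum>m3\<in>set (weights j3).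
        cscale (of_real (wigner_3j j1 j2 j3 m1 m2 m3)) (ket [m1, m2, m3]))"


section \<open>Reduced density matrices, entropy and perfect tensors\<close>

text \<open>
  Reduced density matrix of \<open>|\<psi>><\<psi>|\<close> on the tensor factors with positions in \<open>A\<close>; rows and columns
  are ordered as in \<open>basis (nths js A)\<close>, and the positions outside \<open>A\<close> are traced out.
\<close>

definition reduced_density :: "real list \<Rightarrow> nat set \<Rightarrow> state \<Rightarrow> complex mat" where
  "reduced_density js A \<psi> =
     (let bs = basis (nths js A) in
      mat (length bs) (length bs) (\<lambda>(r, c).
        \<Sum>(x, y) \<in> {(x, y). x \<in> set (basis js) \<and> y \<in> set (basis js) \<and>
            nths x A = bs ! r \<and> nths y A = bs ! c \<and> nths x (- A) = nths y (- A)}.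
          \<psi> x * cnj (\<psi> y)))"

text \<open>Positivity is with respect to the order of \<^theory>\<open>HOL-Library.Complex_Order\<close>, in which
  \<open>0 \<le> z\<close> includes that \<open>z\<close> is real; hence such a matrix is Hermitian.\<close>

definition density_matrices :: "nat \<Rightarrow> complex mat set" where
  "density_matrices d = {\<rho> \<in> carrier_mat d d.
     (\<forall>v\<in>carrier_vec d. 0 \<le> (\<rho> *\<^sub>v v) \<bullet>c v) \<and> (\<Sum>i<d. \<rho> $$ (i, i)) = 1}"

text \<open>The eigenvalues are taken with multiplicity; \<open>0 * ln 0 = 0\<close> as usual.\<close>

definition von_neumann_entropy :: "complex mat \<Rightarrow> real" where
  "von_neumann_entropy \<rho> = - (\<Sum>p\<in>#proots (char_poly \<rho>). Re p * ln (Re p))"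

definition perfect :: "real \<Rightarrow> nat \<Rightarrow> state \<Rightarrow> bool" where
  "perfect j n \<psi> \<longleftrightarrow> unit_vector (replicate n j) \<psi> \<and>
     (\<forall>A. A \<subseteq> {..<n} \<and> 1 \<le> card A \<and> card A \<le> n div 2 \<longrightarrow>
        reduced_density (replicate n j) A \<psi> =
          (1 / of_nat (spin_dim j ^ card A)) \<cdot>\<^sub>m 1\<^sub>m (spin_dim j ^ card A))"

definition invariant_perfect :: "real \<Rightarrow> nat \<Rightarrow> state \<Rightarrow> bool" where
  "invariant_perfect j n \<psi> \<longleftrightarrow> \<psi> \<in> invariant_space (replicate n j) \<and> perfect j n \<psi>"

end

theory Submission
  imports Defs "Jordan_Normal_Form.Schur_Decomposition"
begin

text \<open>
  Let \<open>\<psi>\<close> be invariant. Taking the expectation of \<open>[J_+, |m-1><m|_k]\<close> in \<open>\<psi>\<close> shows that the weights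
  \<open>m - 1\<close> and \<open>m\<close> occur equally often at site \<open>k\<close>, and \<open>J_z \<psi> = 0\<close> makes a one-site reduced density
  matrix diagonal; so it is maximally mixed.

  On three sites the slices of \<open>\<psi>\<close> at fixed \<open>m_3\<close> form, up to alternating signs, a ladder of type
  \<open>V_j3\<close> in \<open>V_j1 \<otimes> V_j2\<close>. Invariance determines \<open>\<psi>\<close> recursively from its coordinate at
  \<open>[j1, j3 - j1, - j3]\<close>, which gives uniqueness of the invariant vector and of the coupled basis alike.
  Existence of the coupled basis comes from lowering an explicit highest weight vector: the ladder
  ends where it should because \<open>||J_- |J M>||\<^sup>2\<close> equals \<open>J (J + 1) - M (M - 1)\<close>, which vanishes at
  \<open>M = - J\<close>.
\<close>


section \<open>Ladder operators on tensor products\<close>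

text \<open>\<open>clebsch_gordan\<close> picks the coupled basis with \<open>THE\<close>, so
  nothing is known about the three-j symbol before existence and uniqueness of that basis are
  settled. The arguments therefore run on \<open>coupled_triple\<close>, the same state built from
  an arbitrary coupled basis, and \<open>three_j_state\<close> is identified with it only
  afterwards. The starting coordinate \<open>[j1, j3 - j1, - j3]\<close> serves two purposes. Its
  third weight is the lowest one, so the raising equations restricted to that slice involve only the
  first two sites. It is also, up to a nonzero factor, the coordinate that the Condon-Shortley
  convention makes positive, so the same coordinate shows that the state is nonzero and fixes the
  phase. The signs (-1)^(j1 - j2 - m3) reflect that |J, - m3> is paired with |j3 m3>: raising on the
  first two factors must cancel raising on the third.\<close>

definition ladder_coeff :: "real \<Rightarrow> real \<Rightarrow> real" where
  "ladder_coeff j m = sqrt (j * (j + 1) - m * (m - 1))"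

lemma spin_dim_eq:
  assumes "j \<in> spins"
  shows "real (spin_dim j) = 2 * j + 1" "0 \<le> j" "0 < spin_dim j"
proof -
  from assms obtain n :: nat where n: "2 * j = real n"
    unfolding spins_def Nats_def by auto
  have "spin_dim j = n + 1"
    unfolding spin_dim_def n by (simp add: nat_eq_iff floor_eq_iff)
  with n show "real (spin_dim j) = 2 * j + 1" "0 \<le> j" "0 < spin_dim j" by auto
qed

lemma weight_iff:
  assumes "j \<in> spins"
  shows "m \<in> set (weights j) \<longleftrightarrow> m + j \<in> \<int> \<and> - j \<le> m \<and> m \<le> j"
proof
  assume "m \<in> set (weights j)"
  then obtain k where k: "k < spin_dim j" "m = real k - j" unfolding weights_def by auto
  then have "real k + 1 \<le> real (spin_dim j)" by linarith
  with k show "m + j \<in> \<int> \<and> - j \<le> m \<and> m \<le> j" using spin_dim_eq[OF assms] by auto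
next
  assume a: "m + j \<in> \<int> \<and> - j \<le> m \<and> m \<le> j"
  then obtain z :: int where z: "m + j = of_int z" unfolding Ints_def by auto
  with a have "0 \<le> z" by linarith
  then obtain k where k: "z = int k" using nonneg_int_cases by blast
  have "real k = m + j" using z k by simp
  then have "real k < real (spin_dim j)" "m = real k - j"
    using a spin_dim_eq[OF assms] by auto
  then show "m \<in> set (weights j)" unfolding weights_def by (auto intro!: image_eqI[of _ _ k])
qed

lemma weights_pred:
  assumes j: "j \<in> spins" and m: "m \<in> set (weights j)" "m \<noteq> - j"
  shows "m - 1 \<in> set (weights j)"
proof -
  obtain z :: int where z: "m + j = of_int z" "- j \<le> m" "m \<le> j"
    using m weight_iff[OF j] by (auto simp: Ints_def)
  then have "1 \<le> z" using m(2) by linarith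
  moreover have "m - 1 + j = of_int (z - 1)" using z by simp
  then have "m - 1 + j \<in> \<int>" by (metis Ints_of_int)
  ultimately show ?thesis unfolding weight_iff[OF j] using z by auto
qed

lemma weights_uminus:
  assumes j: "j \<in> spins" and m: "m \<in> set (weights j)"
  shows "- m \<in> set (weights j)"
proof -
  have "2 * j \<in> \<int>" using j by (auto simp: spins_def elim: Nats_cases)
  moreover have "m + j \<in> \<int>" using m weight_iff[OF j] by blast
  ultimately have "2 * j - (m + j) \<in> \<int>" by (rule Ints_diff)
  then show ?thesis using m by (simp add: weight_iff[OF j] algebra_simps)
qed

lemma weights_succ:
  assumes j: "j \<in> spins" and m: "m \<in> set (weights j)" "m \<noteq> j"
  shows "m + 1 \<in> set (weights j)"
  using weights_uminus[OF j weights_pred[OF j weights_uminus[OF j m(1)]]] m(2)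
  by (simp add: add.commute)

lemma distinct_weights: "distinct (weights j)"
  unfolding weights_def by (auto simp: distinct_map inj_on_def)

lemma length_weights: "length (weights j) = spin_dim j"
  unfolding weights_def by simp

lemma ladder_coeff_factor: "ladder_coeff j m = sqrt ((j + m) * (j - m + 1))"
  unfolding ladder_coeff_def by (simp add: algebra_simps)

text \<open>\<open>ladder_coeff j m\<close> is the matrix element joining m - 1 and m, for raising
  and lowering alike, indexed by the upper weight. These two zeros cancel every term that would
  leave the weight range.\<close>

lemma ladder_coeff_boundary [simp]: "ladder_coeff j (- j) = 0" "ladder_coeff j (j + 1) = 0"
  unfolding ladder_coeff_factor by simp_all

lemma ladder_coeff_pos: "- j < m \<Longrightarrow> m \<le> j \<Longrightarrow> 0 < ladder_coeff j m"
  unfolding ladder_coeff_factor by (simp add: zero_less_mult_iff)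

lemma ladder_coeff_square:
  assumes "- j \<le> m" "m \<le> j + 1"
  shows "(ladder_coeff j m)\<^sup>2 = (j + m) * (j - m + 1)"
  unfolding ladder_coeff_factor using assms by simp

text \<open>This is [J_+, J_-] = 2 J_z evaluated on |j m>.\<close>

lemma ladder_coeff_square_diff:
  assumes "- j \<le> m" "m \<le> j"
  shows "(ladder_coeff j m)\<^sup>2 - (ladder_coeff j (m + 1))\<^sup>2 = 2 * m"
  using assms by (simp add: ladder_coeff_square algebra_simps)

section \<open>Coordinate formulas for the total operators\<close>

lemma basis_iff:
  "ms \<in> set (basis js) \<longleftrightarrow> length ms = length js \<and> (\<forall>i<length js. ms ! i \<in> set (weights (js ! i)))"
  unfolding basis_def product_lists_set by (auto simp: list_all2_conv_all_nth)

lemma basis_update_iff: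
  assumes "ms \<in> set (basis js)" "i < length js"
  shows "ms[i := m] \<in> set (basis js) \<longleftrightarrow> m \<in> set (weights (js ! i))"
  using assms by (auto simp: basis_iff nth_list_update)

lemma tensor_space_iff: "\<psi> \<in> tensor_space js \<longleftrightarrow> (\<forall>ms. ms \<notin> set (basis js) \<longrightarrow> \<psi> ms = 0)"
  unfolding tensor_space_def by simp

lemma total_op_tensor_space: "total_op A js \<psi> \<in> tensor_space js"
  unfolding tensor_space_def total_op_def site_op_def by simp

text \<open>The ladder operators and J_z have at most one nonzero entry per row, here in column w. A
  w outside the weights is harmless: the updated list leaves the basis, where \<open>\<psi>\<close>
  vanishes.\<close>

lemma site_op_single:
  assumes \<psi>: "\<psi> \<in> tensor_space js" and ms: "ms \<in> set (basis js)" and i: "i < length js"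
    and A: "\<And>m. m \<noteq> w \<Longrightarrow> A (js ! i) (ms ! i) m = 0"
  shows "site_op A js i \<psi> ms = A (js ! i) (ms ! i) w * \<psi> (ms[i := w])"
proof -
  have "site_op A js i \<psi> ms =
      (\<Sum>m\<in>set (weights (js ! i)). if m = w then A (js ! i) (ms ! i) w * \<psi> (ms[i := w]) else 0)"
    unfolding site_op_def if_P[OF ms] by (rule sum.cong) (auto simp: A)
  also have "\<dots> = (if w \<in> set (weights (js ! i))
      then A (js ! i) (ms ! i) w * \<psi> (ms[i := w]) else 0)"
    by (subst sum.delta) auto
  also have "\<dots> = A (js ! i) (ms ! i) w * \<psi> (ms[i := w])"
  proof (cases "w \<in> set (weights (js ! i))")
    case False
    then have "ms[i := w] \<notin> set (basis js)" using ms i by (auto simp: basis_iff)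
    then show ?thesis using \<psi> False by (simp add: tensor_space_iff)
  qed simp
  finally show ?thesis .
qed

text \<open>Row m of J_+ has its entry in column m - 1, so the upper weight is m itself; for J_- the
  column and the upper weight are both m + 1.\<close>

lemma total_op_spin_plus:
  assumes "\<psi> \<in> tensor_space js" "ms \<in> set (basis js)"
  shows "total_op spin_plus js \<psi> ms =
    (\<Sum>i<length js. of_real (ladder_coeff (js ! i) (ms ! i)) * \<psi> (ms[i := ms ! i - 1]))"
  unfolding total_op_def
proof (rule sum.cong[OF refl])
  fix i assume i: "i \<in> {..<length js}"
  show "site_op spin_plus js i \<psi> ms =
      of_real (ladder_coeff (js ! i) (ms ! i)) * \<psi> (ms[i := ms ! i - 1])"
    by (subst site_op_single[OF assms, where w = "ms ! i - 1"])
      (use i in \<open>auto simp: spin_plus_def ladder_coeff_def algebra_simps\<close>)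
qed

lemma total_op_spin_minus:
  assumes "\<psi> \<in> tensor_space js" "ms \<in> set (basis js)"
  shows "total_op spin_minus js \<psi> ms =
    (\<Sum>i<length js. of_real (ladder_coeff (js ! i) (ms ! i + 1)) * \<psi> (ms[i := ms ! i + 1]))"
  unfolding total_op_def
proof (rule sum.cong[OF refl])
  fix i assume i: "i \<in> {..<length js}"
  show "site_op spin_minus js i \<psi> ms =
      of_real (ladder_coeff (js ! i) (ms ! i + 1)) * \<psi> (ms[i := ms ! i + 1])"
    by (subst site_op_single[OF assms, where w = "ms ! i + 1"])
      (use i in \<open>auto simp: spin_minus_def ladder_coeff_def algebra_simps\<close>)
qed

lemma total_op_spin_z:
  assumes "\<psi> \<in> tensor_space js"
  shows "total_op spin_z js \<psi> = (\<lambda>ms. of_real (sum_list ms) * \<psi> ms)"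
proof
  fix ms
  show "total_op spin_z js \<psi> ms = of_real (sum_list ms) * \<psi> ms"
  proof (cases "ms \<in> set (basis js)")
    case True
    have "total_op spin_z js \<psi> ms = (\<Sum>i<length js. of_real (ms ! i) * \<psi> ms)"
      unfolding total_op_def
    proof (rule sum.cong[OF refl])
      fix i assume i: "i \<in> {..<length js}"
      show "site_op spin_z js i \<psi> ms = of_real (ms ! i) * \<psi> ms"
        by (subst site_op_single[OF assms True, where w = "ms ! i"])
          (use i in \<open>auto simp: spin_z_def\<close>)
    qed
    also have "\<dots> = of_real (sum_list ms) * \<psi> ms"
      using True unfolding sum_list_sum_nth
      by (simp add: sum_distrib_right basis_iff atLeast0LessThan)
    finally show ?thesis .
  next
    case False
    then show ?thesis
      using assms total_op_tensor_space[of spin_z js \<psi>] by (simp add: tensor_space_iff)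
  qed
qed

section \<open>Linearity, and invariance in terms of ladder operators\<close>

lemma tensor_space_add: "\<phi> \<in> tensor_space js \<Longrightarrow> \<psi> \<in> tensor_space js \<Longrightarrow> \<phi> + \<psi> \<in> tensor_space js"
  and tensor_space_cscale: "\<psi> \<in> tensor_space js \<Longrightarrow> cscale c \<psi> \<in> tensor_space js"
  and tensor_space_zero: "0 \<in> tensor_space js"
  by (auto simp: tensor_space_iff cscale_def)

lemma total_op_add: "total_op A js (\<phi> + \<psi>) = total_op A js \<phi> + total_op A js \<psi>"
proof -
  have "site_op A js i (\<phi> + \<psi>) ms = site_op A js i \<phi> ms + site_op A js i \<psi> ms" for i ms
    unfolding site_op_def by (cases "ms \<in> set (basis js)") (simp_all add: distrib_left sum.distrib)
  then show ?thesis by (simp add: total_op_def fun_eq_iff sum.distrib)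
qed

lemma total_op_cscale: "total_op A js (cscale c \<psi>) = cscale c (total_op A js \<psi>)"
proof -
  have "site_op A js i (cscale c \<psi>) ms = c * site_op A js i \<psi> ms" for i ms
    unfolding site_op_def
    by (cases "ms \<in> set (basis js)") (simp_all add: cscale_def sum_distrib_left mult.left_commute)
  then show ?thesis by (simp add: total_op_def fun_eq_iff sum_distrib_left cscale_def)
qed

lemma total_op_zero: "total_op A js 0 = 0"
proof -
  have "site_op A js i 0 ms = 0" for i ms
    unfolding site_op_def by (cases "ms \<in> set (basis js)") simp_all
  then show ?thesis by (simp add: total_op_def fun_eq_iff)
qed

lemma cscale_simps [simp]: "cscale 0 \<psi> = 0" "cscale 1 \<psi> = \<psi>"
  "cscale c (cscale d \<psi>) = cscale (c * d) \<psi>" "cscale c 0 = 0" "cscale c \<psi> ms = c * \<psi> ms"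
  by (auto simp: cscale_def fun_eq_iff)

lemma total_op_spin_x:
  "total_op spin_x js \<psi> = cscale (1 / 2) (total_op spin_plus js \<psi> + total_op spin_minus js \<psi>)"
proof -
  have "site_op spin_x js i \<psi> ms = 1 / 2 * (site_op spin_plus js i \<psi> ms + site_op spin_minus js i \<psi> ms)"
    for i ms
  proof (cases "ms \<in> set (basis js)")
    case True
    show ?thesis
      unfolding site_op_def if_P[OF True] sum.distrib[symmetric] sum_distrib_left
      by (intro sum.cong refl) (simp add: spin_x_def field_simps)
  qed (simp add: site_op_def)
  then have "site_op spin_x js i \<psi> =
      (\<lambda>ms. 1 / 2 * (site_op spin_plus js i \<psi> ms + site_op spin_minus js i \<psi> ms))" for i
    by blast
  then show ?thesis
    by (simp only: total_op_def fun_eq_iff cscale_simps plus_fun_apply sum_distrib_left[symmetric]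
        sum.distrib) simp
qed

lemma total_op_spin_y:
  "total_op spin_y js \<psi> =
    cscale (1 / (2 * \<i>)) (total_op spin_plus js \<psi> + cscale (- 1) (total_op spin_minus js \<psi>))"
proof -
  have "site_op spin_y js i \<psi> ms =
      1 / (2 * \<i>) * (site_op spin_plus js i \<psi> ms - site_op spin_minus js i \<psi> ms)" for i ms
  proof (cases "ms \<in> set (basis js)")
    case True
    show ?thesis
      unfolding site_op_def if_P[OF True] sum_subtractf[symmetric] sum_distrib_left
      by (intro sum.cong refl) (simp add: spin_y_def field_simps)
  qed (simp add: site_op_def)
  then have "site_op spin_y js i \<psi> =
      (\<lambda>ms. 1 / (2 * \<i>) * (site_op spin_plus js i \<psi> ms - site_op spin_minus js i \<psi> ms))" for i
    by blast
  then show ?thesis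
    by (simp only: total_op_def fun_eq_iff cscale_simps plus_fun_apply sum_distrib_left[symmetric]
        sum_subtractf) simp
qed

text \<open>J_x and J_y together carry the same information as J_+ and J_-, because J_+ = J_x + i
  J_y and J_- = J_x - i J_y.\<close>

lemma invariant_space_iff:
  "\<psi> \<in> invariant_space js \<longleftrightarrow> \<psi> \<in> tensor_space js \<and> total_op spin_plus js \<psi> = 0 \<and>
     total_op spin_minus js \<psi> = 0 \<and> total_op spin_z js \<psi> = 0"
proof -
  have 1: "total_op spin_plus js \<psi> = total_op spin_x js \<psi> + cscale \<i> (total_op spin_y js \<psi>)"
    "total_op spin_minus js \<psi> = total_op spin_x js \<psi> + cscale (- \<i>) (total_op spin_y js \<psi>)"
    unfolding total_op_spin_x total_op_spin_y by (auto simp: fun_eq_iff field_simps)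
  have "total_op spin_plus js \<psi> = 0" "total_op spin_minus js \<psi> = 0"
    if "total_op spin_x js \<psi> = 0" "total_op spin_y js \<psi> = 0"
    unfolding 1 that by simp_all
  moreover have "total_op spin_x js \<psi> = 0" "total_op spin_y js \<psi> = 0"
    if "total_op spin_plus js \<psi> = 0" "total_op spin_minus js \<psi> = 0"
    unfolding total_op_spin_x total_op_spin_y that by simp_all
  ultimately show ?thesis unfolding invariant_space_def by blast
qed

lemma invariant_weight_zero:
  assumes "\<psi> \<in> invariant_space js" "\<psi> ms \<noteq> 0"
  shows "sum_list ms = 0"
proof -
  have "\<psi> \<in> tensor_space js" "total_op spin_z js \<psi> = 0"
    using assms by (auto simp: invariant_space_iff)
  from this(2) have "of_real (sum_list ms) * \<psi> ms = 0"
    unfolding total_op_spin_z[OF \<open>\<psi> \<in> tensor_space js\<close>] by (metis zero_fun_apply)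
  with assms show ?thesis by (metis mult_eq_0_iff of_real_eq_0_iff)
qed

section \<open>Inner product and adjointness\<close>

definition state_inner :: "real list \<Rightarrow> state \<Rightarrow> state \<Rightarrow> complex" where
  "state_inner js \<phi> \<psi> = (\<Sum>ms\<in>set (basis js). \<phi> ms * cnj (\<psi> ms))"

text \<open>At each site, lowering the entry by one matches the lists not at the bottom with those
  not at the top. The unmatched lists carry a vanishing ladder coefficient.\<close>

lemma spin_plus_adjoint:
  assumes js: "set js \<subseteq> spins" and \<phi>: "\<phi> \<in> tensor_space js" and \<psi>: "\<psi> \<in> tensor_space js"
  shows "state_inner js (total_op spin_plus js \<phi>) \<psi> = state_inner js \<phi> (total_op spin_minus js \<psi>)"
proof -
  define a where "a i m = complex_of_real (ladder_coeff (js ! i) m)" for i m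
  let ?B = "set (basis js)"
  have 1: "(\<Sum>x\<in>?B. a i (x ! i) * \<phi> (x[i := x ! i - 1]) * cnj (\<psi> x)) =
      (\<Sum>x\<in>?B. \<phi> x * (a i (x ! i + 1) * cnj (\<psi> (x[i := x ! i + 1]))))"
    if i: "i < length js" for i
  proof (rule sum.reindex_bij_witness_not_neutral[where
        S' = "{x \<in> ?B. x ! i = - (js ! i)}" and T' = "{x \<in> ?B. x ! i = js ! i}"
        and i = "\<lambda>x. x[i := x ! i + 1]" and j = "\<lambda>x. x[i := x ! i - 1]"])
    have j: "js ! i \<in> spins" using i js by auto
    fix x
    {
      assume "x \<in> ?B - {x \<in> ?B. x ! i = - (js ! i)}"
      then have x: "x \<in> ?B" and ne: "x ! i \<noteq> - (js ! i)" by auto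
      then have l: "length x = length js" and wi: "x ! i \<in> set (weights (js ! i))"
        using i by (auto simp: basis_iff)
      then show "x[i := x ! i - 1] \<in> ?B - {x \<in> ?B. x ! i = js ! i}"
        using weights_pred[OF j wi ne] i weight_iff[OF j] by (auto simp: basis_update_iff[OF x])
      show "(x[i := x ! i - 1])[i := x[i := x ! i - 1] ! i + 1] = x"
        using l i by simp
    }
    {
      assume "x \<in> ?B - {x \<in> ?B. x ! i = js ! i}"
      then have x: "x \<in> ?B" and ne: "x ! i \<noteq> js ! i" by auto
      then have l: "length x = length js" and wi: "x ! i \<in> set (weights (js ! i))"
        using i by (auto simp: basis_iff)
      then show "x[i := x ! i + 1] \<in> ?B - {x \<in> ?B. x ! i = - (js ! i)}"
        using weights_succ[OF j wi ne] i weight_iff[OF j] by (auto simp: basis_update_iff[OF x])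
      show "(x[i := x ! i + 1])[i := x[i := x ! i + 1] ! i - 1] = x"
        using l i by simp
    }
    {
      assume "x \<in> {x \<in> ?B. x ! i = - (js ! i)}"
      then show "a i (x ! i) * \<phi> (x[i := x ! i - 1]) * cnj (\<psi> x) = 0" by (simp add: a_def)
    }
    {
      assume "x \<in> {x \<in> ?B. x ! i = js ! i}"
      then show "\<phi> x * (a i (x ! i + 1) * cnj (\<psi> (x[i := x ! i + 1]))) = 0" by (simp add: a_def)
    }
    {
      assume "x \<in> ?B"
      then have l: "length x = length js" by (auto simp: basis_iff)
      show "\<phi> (x[i := x ! i - 1]) * (a i (x[i := x ! i - 1] ! i + 1) *
            cnj (\<psi> ((x[i := x ! i - 1])[i := x[i := x ! i - 1] ! i + 1]))) =
          a i (x ! i) * \<phi> (x[i := x ! i - 1]) * cnj (\<psi> x)"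
        using i l by simp
    }
  qed auto
  have "state_inner js (total_op spin_plus js \<phi>) \<psi> =
      (\<Sum>x\<in>?B. \<Sum>i<length js. a i (x ! i) * \<phi> (x[i := x ! i - 1]) * cnj (\<psi> x))"
    unfolding state_inner_def
    by (intro sum.cong refl) (simp add: total_op_spin_plus[OF \<phi>] sum_distrib_right a_def)
  also have "\<dots> = (\<Sum>i<length js. \<Sum>x\<in>?B. a i (x ! i) * \<phi> (x[i := x ! i - 1]) * cnj (\<psi> x))"
    by (rule sum.swap)
  also have "\<dots> = (\<Sum>i<length js. \<Sum>x\<in>?B. \<phi> x * (a i (x ! i + 1) * cnj (\<psi> (x[i := x ! i + 1]))))"
    by (intro sum.cong refl 1) simp
  also have "\<dots> = (\<Sum>x\<in>?B. \<Sum>i<length js. \<phi> x * (a i (x ! i + 1) * cnj (\<psi> (x[i := x ! i + 1]))))"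
    by (rule sum.swap)
  also have "\<dots> = state_inner js \<phi> (total_op spin_minus js \<psi>)"
    unfolding state_inner_def
    by (intro sum.cong refl) (simp add: total_op_spin_minus[OF \<psi>] sum_distrib_left a_def)
  finally show ?thesis .
qed


section \<open>Entropy of density matrices\<close>

lemma proots_prod_linear_factors: "proots (\<Prod>e\<leftarrow>es. [:- e, 1:]) = mset (es :: complex list)"
proof (induction es)
  case (Cons e es)
  have "(\<Prod>e\<leftarrow>es. [:- e, 1:]) \<noteq> (0 :: complex poly)" by (auto simp: prod_list_zero_iff)
  then have "proots ([:- e, 1:] * (\<Prod>e\<leftarrow>es. [:- e, 1:])) = {#e#} + mset es"
    by (subst proots_mult) (auto simp: Cons.IH simp del: mult_pCons_left)
  then show ?case by (simp del: mult_pCons_left)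
qed simp

lemma char_poly_proots:
  fixes A :: "complex mat"
  assumes "A \<in> carrier_mat n n"
  obtains es where "length es = n" "char_poly A = (\<Prod>e\<leftarrow>es. [:- e, 1:])"
    "proots (char_poly A) = mset es"
  using char_poly_factorized[OF assms] proots_prod_linear_factors by metis

text \<open>Schur triangularisation puts the eigenvalues on a diagonal, and the trace is invariant
  under similarity because it is cyclic.\<close>

lemma sum_eigenvalues_eq_trace:
  fixes A :: "complex mat"
  assumes A: "A \<in> carrier_mat n n" and es: "char_poly A = (\<Prod>e\<leftarrow>es. [:- e, 1:])"
  shows "sum_list es = (\<Sum>i<n. A $$ (i, i))"
proof -
  obtain B P Q where B: "similar_mat_wit A B P Q" "diag_mat B = es"
    using schur_decomposition[OF A es] by (metis prod_cases3)
  note w = similar_mat_witD2[OF A B(1)]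
  have tr: "(\<Sum>i<n. (X * Y) $$ (i, i)) = (\<Sum>i<n. (Y * X) $$ (i, i))"
    if "X \<in> carrier_mat n n" "Y \<in> carrier_mat n n" for X Y :: "complex mat"
  proof -
    have "(\<Sum>i<n. (X * Y) $$ (i, i)) = (\<Sum>i<n. \<Sum>k<n. X $$ (i, k) * Y $$ (k, i))"
      using that by (auto simp: scalar_prod_def atLeast0LessThan intro!: sum.cong)
    also have "\<dots> = (\<Sum>k<n. \<Sum>i<n. X $$ (i, k) * Y $$ (k, i))" by (rule sum.swap)
    also have "\<dots> = (\<Sum>i<n. (Y * X) $$ (i, i))"
      using that by (auto simp: scalar_prod_def atLeast0LessThan mult.commute intro!: sum.cong)
    finally show ?thesis .
  qed
  have "(\<Sum>i<n. A $$ (i, i)) = (\<Sum>i<n. (P * (B * Q)) $$ (i, i))"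
    using w by (simp add: assoc_mult_mat[of P n n B n Q n])
  also have "\<dots> = (\<Sum>i<n. (B * Q * P) $$ (i, i))" using w by (intro tr) auto
  also have "B * Q * P = B" using w by (simp add: assoc_mult_mat[of B n n Q n P n])
  also have "(\<Sum>i<n. B $$ (i, i)) = sum_list es"
    using w unfolding B(2)[symmetric] diag_mat_def by (simp add: sum_list_sum_nth atLeast0LessThan)
  finally show ?thesis by simp
qed

text \<open>For an eigenvector v of p, the number p <v, v> is a value of the positive form, and the
  complex order then forces p to be real and nonnegative. The total mass is the trace.\<close>

lemma density_matrix_proots:
  assumes "\<sigma> \<in> density_matrices d"
  obtains ps where "proots (char_poly \<sigma>) = mset ps" "length ps = d"
    "\<And>p. p \<in> set ps \<Longrightarrow> 0 \<le> Re p" "(\<Sum>p\<leftarrow>ps. Re p) = 1"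
proof -
  from assms have \<sigma>: "\<sigma> \<in> carrier_mat d d"
    and pos: "\<And>v. v \<in> carrier_vec d \<Longrightarrow> 0 \<le> (\<sigma> *\<^sub>v v) \<bullet>c v"
    and tr: "(\<Sum>i<d. \<sigma> $$ (i, i)) = 1"
    unfolding density_matrices_def by auto
  obtain ps where ps: "length ps = d" "char_poly \<sigma> = (\<Prod>p\<leftarrow>ps. [:- p, 1:])"
    "proots (char_poly \<sigma>) = mset ps"
    using char_poly_proots[OF \<sigma>] by blast
  have "0 \<le> Re p" if "p \<in> set ps" for p
  proof -
    have "poly (char_poly \<sigma>) p = 0"
      using that unfolding ps(2) poly_prod_list by (auto simp: prod_list_zero_iff intro!: image_eqI)
    then obtain v where v: "v \<in> carrier_vec d" "v \<noteq> 0\<^sub>v d" "\<sigma> *\<^sub>v v = p \<cdot>\<^sub>v v"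
      using eigenvalue_root_char_poly[OF \<sigma>] \<sigma> unfolding eigenvalue_def eigenvector_def by auto
    have "0 \<le> p * (v \<bullet>c v)" using pos[OF v(1)] v by simp
    moreover have "0 < v \<bullet>c v" using v by (simp add: conjugate_square_greater_0_vec)
    ultimately show ?thesis by (auto simp: less_eq_complex_def less_complex_def zero_le_mult_iff)
  qed
  moreover have "(\<Sum>p\<leftarrow>ps. Re p) = Re (sum_list ps)" by (induction ps) auto
  then have "(\<Sum>p\<leftarrow>ps. Re p) = 1"
    unfolding sum_eigenvalues_eq_trace[OF \<sigma> ps(2)] tr by simp
  ultimately show thesis using that ps by blast
qed

lemma von_neumann_entropy_le:
  assumes "\<sigma> \<in> density_matrices d" "0 < d"
  shows "von_neumann_entropy \<sigma> \<le> ln (real d)"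
proof -
  obtain ps where ps: "proots (char_poly \<sigma>) = mset ps" "length ps = d"
    "\<And>p. p \<in> set ps \<Longrightarrow> 0 \<le> Re p" "(\<Sum>p\<leftarrow>ps. Re p) = 1"
    using density_matrix_proots[OF assms(1)] by blast
  \<comment> \<open>Gibbs' inequality against the uniform distribution, from \<open>ln x \<le> x - 1\<close>.\<close>
  have gibbs: "- (x * ln x) - x * ln d \<le> 1 / d - x" if "0 \<le> x" for x :: real
  proof (cases "x = 0")
    case False
    then have "ln (1 / (x * d)) \<le> 1 / (x * d) - 1"
      using that assms(2) by (intro ln_le_minus_one) simp
    then have "x * ln (1 / (x * d)) \<le> x * (1 / (x * d) - 1)"
      using that by (rule mult_left_mono)
    moreover have "x * ln (1 / (x * d)) = - (x * ln x) - x * ln d"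
      using False that assms(2) by (simp add: ln_div ln_mult algebra_simps)
    moreover have "x * (1 / (x * d) - 1) = 1 / d - x"
      using False by (simp add: right_diff_distrib)
    ultimately show ?thesis by simp
  qed simp
  have "von_neumann_entropy \<sigma> = (\<Sum>p\<leftarrow>ps. - (Re p * ln (Re p)))"
    unfolding von_neumann_entropy_def ps(1)
    by (simp add: sum_mset_sum_list uminus_sum_list_map comp_def flip: mset_map)
  also have "\<dots> - (\<Sum>p\<leftarrow>ps. Re p) * ln d = (\<Sum>p\<leftarrow>ps. - (Re p * ln (Re p)) - Re p * ln d)"
    by (simp add: sum_list_subtractf sum_list_mult_const)
  also have "\<dots> \<le> (\<Sum>p\<leftarrow>ps. 1 / d - Re p)"
    by (intro sum_list_mono gibbs ps(3))
  \<comment> \<open>The eigenvalues and the d copies of 1/d both have total mass 1.\<close>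
  also have "\<dots> = 0"
    using ps(2,4) assms(2) by (simp add: sum_list_subtractf sum_list_triv)
  finally show ?thesis using ps(4) by simp
qed

lemma von_neumann_entropy_maximally_mixed:
  assumes "0 < d"
  shows "von_neumann_entropy (of_real (1 / real d) \<cdot>\<^sub>m 1\<^sub>m d) = ln (real d)"
proof -
  let ?A = "of_real (1 / real d) \<cdot>\<^sub>m 1\<^sub>m d :: complex mat"
  have "char_poly ?A = (\<Prod>a\<leftarrow>diag_mat ?A. [:- a, 1:])"
    by (rule char_poly_upper_triangular[of _ d]) auto
  also have "diag_mat ?A = replicate d (of_real (1 / real d))"
    by (auto simp: diag_mat_def intro!: nth_equalityI)
  finally have "proots (char_poly ?A) = mset (replicate d (of_real (1 / real d)))"
    using proots_prod_linear_factors by metis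
  then show ?thesis
    using assms unfolding von_neumann_entropy_def
    by (simp add: ln_div)
qed


section \<open>One-site reduced density matrices of invariant vectors\<close>

lemma invariant_site_weight_step:
  assumes js: "set js \<subseteq> spins" and \<psi>: "\<psi> \<in> invariant_space js" and k: "k < length js"
    and m: "- (js ! k) < m" "m \<le> js ! k" "m \<in> set (weights (js ! k))" "m - 1 \<in> set (weights (js ! k))"
  shows "(\<Sum>x | x \<in> set (basis js) \<and> x ! k = m. \<psi> x * cnj (\<psi> x)) =
    (\<Sum>x | x \<in> set (basis js) \<and> x ! k = m - 1. \<psi> x * cnj (\<psi> x))"
proof -
  let ?B = "set (basis js)"
  have ts: "\<psi> \<in> tensor_space js" and P: "total_op spin_plus js \<psi> = 0"
    and M: "total_op spin_minus js \<psi> = 0"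
    using \<psi> by (auto simp: invariant_space_iff)
  \<comment> \<open>\<open>\<phi> = (|m-1><m|)_k \<psi>\<close>; the identity is \<open><\<psi>, [J_+, |m-1><m|_k] \<psi>> = 0\<close>.\<close>
  define \<phi> where "\<phi> x = (if x \<in> ?B \<and> x ! k = m - 1 then \<psi> (x[k := m]) else 0)" for x
  define a where "a i x = complex_of_real (ladder_coeff (js ! i) x)" for i x
  have \<phi>: "\<phi> \<in> tensor_space js" by (simp add: tensor_space_iff \<phi>_def)
  \<comment> \<open>With E = |m-1><m| at site k, J_+ E \<open>\<psi>\<close> equals [J_+, E]
    \<open>\<psi>\<close> since J_+ kills \<open>\<psi>\<close>. The commutator is the ladder
    coefficient times |m><m| - |m-1><m-1|, which are the two terms on the right.\<close>
  have comm: "total_op spin_plus js \<phi> x =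
      (if x ! k = m then a k m * \<psi> x else 0) - (if x ! k = m - 1 then a k m * \<psi> x else 0)"
    if x: "x \<in> ?B" for x
  proof -
    have len: "length x = length js" using x by (simp add: basis_iff)
    have upd: "x[k := m'] \<in> ?B" if "m' \<in> set (weights (js ! k))" for m'
      using that k by (simp add: basis_update_iff[OF x])
    \<comment> \<open>\<open>\<phi>\<close> is cut off outside the basis by definition; here
      \<open>\<psi>\<close> is seen to vanish at the corresponding places.\<close>
    have out: "\<psi> (x[i := x ! i - 1, k := m]) = 0"
      if "x[i := x ! i - 1] \<notin> ?B" "i < length js" "i \<noteq> k" for i
    proof -
      have "x ! i - 1 \<notin> set (weights (js ! i))"
        using that by (simp add: basis_update_iff[OF x])
      then have "x[k := m, i := x ! i - 1] \<notin> ?B"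
        using that by (simp add: basis_update_iff[OF upd[OF m(3)]])
      then have "x[i := x ! i - 1, k := m] \<notin> ?B"
        using that by (simp add: list_update_swap)
      then show ?thesis using ts by (simp add: tensor_space_iff)
    qed
    \<comment> \<open>Raising at another site commutes with replacing the entry at k.\<close>
    have others: "a i (x ! i) * \<phi> (x[i := x ! i - 1]) =
        (if x ! k = m - 1 then a i (x[k := m] ! i) * \<psi> ((x[k := m])[i := x[k := m] ! i - 1]) else 0)"
      if i: "i < length js" "i \<noteq> k" for i
      using out[OF _ i] i len
      by (cases "x[i := x ! i - 1] \<in> ?B") (auto simp: \<phi>_def list_update_swap)
    have self: "a k (x ! k) * \<phi> (x[k := x ! k - 1]) = (if x ! k = m then a k m * \<psi> x else 0)"
      using len k m(4) upd by (auto simp: \<phi>_def)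
    \<comment> \<open>J_+ \<open>\<psi>\<close> = 0, read at \<open>x[k := m]\<close> and solved for
      the summands of the sites other than k.\<close>
    have rest: "(\<Sum>i\<in>{..<length js} - {k}. a i (x[k := m] ! i) * \<psi> ((x[k := m])[i := x[k := m] ! i - 1])) =
        - (a k m * \<psi> (x[k := m - 1]))"
    proof -
      have "0 = (\<Sum>i<length js. a i (x[k := m] ! i) * \<psi> ((x[k := m])[i := x[k := m] ! i - 1]))"
        using total_op_spin_plus[OF ts upd[OF m(3)]] P by (simp add: a_def)
      also have "\<dots> = a k m * \<psi> (x[k := m - 1]) +
          (\<Sum>i\<in>{..<length js} - {k}. a i (x[k := m] ! i) * \<psi> ((x[k := m])[i := x[k := m] ! i - 1]))"
        using k len by (subst sum.remove[of _ k]) auto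
      finally show ?thesis by (simp add: eq_neg_iff_add_eq_0 add.commute)
    qed
    have "total_op spin_plus js \<phi> x = (\<Sum>i<length js. a i (x ! i) * \<phi> (x[i := x ! i - 1]))"
      unfolding total_op_spin_plus[OF \<phi> x] a_def ..
    also have "\<dots> = (if x ! k = m then a k m * \<psi> x else 0) +
        (\<Sum>i\<in>{..<length js} - {k}. a i (x ! i) * \<phi> (x[i := x ! i - 1]))"
      using k by (subst sum.remove[of _ k]) (auto simp: self)
    also have "(\<Sum>i\<in>{..<length js} - {k}. a i (x ! i) * \<phi> (x[i := x ! i - 1])) =
        (\<Sum>i\<in>{..<length js} - {k}. if x ! k = m - 1
          then a i (x[k := m] ! i) * \<psi> ((x[k := m])[i := x[k := m] ! i - 1]) else 0)"
      by (intro sum.cong refl others) auto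
    also have "\<dots> = - (if x ! k = m - 1 then a k m * \<psi> x else 0)"
    proof (cases "x ! k = m - 1")
      case True
      then have "x[k := m - 1] = x" by (metis list_update_id)
      then show ?thesis unfolding if_P[OF True] rest by simp
    qed simp
    finally show ?thesis by simp
  qed
  \<comment> \<open>J_- kills \<open>\<psi>\<close> as well, so moving J_+ across the inner product
    makes the expectation of the commutator vanish. Its positive ladder coefficient can then be
    cancelled.\<close>
  have "0 = state_inner js \<phi> (total_op spin_minus js \<psi>)"
    unfolding M by (simp add: state_inner_def)
  also have "\<dots> = state_inner js (total_op spin_plus js \<phi>) \<psi>"
    by (rule spin_plus_adjoint[OF js \<phi> ts, symmetric])
  also have "\<dots> = (\<Sum>x\<in>?B. a k m * ((if x ! k = m then \<psi> x * cnj (\<psi> x) else 0) -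
      (if x ! k = m - 1 then \<psi> x * cnj (\<psi> x) else 0)))"
    unfolding state_inner_def by (intro sum.cong refl) (auto simp: comm)
  also have "\<dots> = a k m * ((\<Sum>x | x \<in> ?B \<and> x ! k = m. \<psi> x * cnj (\<psi> x)) -
      (\<Sum>x | x \<in> ?B \<and> x ! k = m - 1. \<psi> x * cnj (\<psi> x)))"
    by (simp add: sum_distrib_left[symmetric] sum_subtractf sum.inter_filter)
  finally show ?thesis
    using ladder_coeff_pos[OF m(1,2)] by (simp add: a_def)
qed

text \<open>The step lemma makes all weights at site k equally likely, starting from the lowest; the
  d equal probabilities add up to the squared norm 1.\<close>

lemma invariant_site_weight:
  assumes js: "set js \<subseteq> spins" and \<psi>: "\<psi> \<in> invariant_space js" "unit_vector js \<psi>"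
    and k: "k < length js" and m: "m \<in> set (weights (js ! k))"
  shows "(\<Sum>x | x \<in> set (basis js) \<and> x ! k = m. \<psi> x * cnj (\<psi> x)) = 1 / of_nat (spin_dim (js ! k))"
proof -
  let ?j = "js ! k"
  have j: "?j \<in> spins" using js k by auto
  define p where "p m = (\<Sum>x | x \<in> set (basis js) \<and> x ! k = m. \<psi> x * cnj (\<psi> x))" for m
  have const: "p (real n - ?j) = p (- ?j)" if "n < spin_dim ?j" for n
    using that
  proof (induction n)
    case (Suc n)
    have mem: "real n' - ?j \<in> set (weights ?j)" if "n' < spin_dim ?j" for n'
      using that unfolding weights_def by auto
    have "real (Suc n) - ?j \<le> ?j"
      using mem[OF Suc.prems] weight_iff[OF j] by blast
    moreover have "real (Suc n) - ?j - 1 = real n - ?j" by simp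
    ultimately have "p (real (Suc n) - ?j) = p (real n - ?j)"
      using invariant_site_weight_step[OF js \<psi>(1) k, of "real (Suc n) - ?j"]
        mem[OF Suc.prems] mem[of n] Suc.prems
      unfolding p_def by simp
    then show ?case using Suc by simp
  qed simp
  have eq: "p m' = p (- ?j)" if "m' \<in> set (weights ?j)" for m'
    using that const unfolding weights_def by auto
  have "1 = (\<Sum>x\<in>set (basis js). \<psi> x * cnj (\<psi> x))"
    using \<psi>(2) unfolding unit_vector_def complex_norm_square[symmetric] of_real_sum[symmetric] by simp
  also have "\<dots> = (\<Sum>m\<in>set (weights ?j). p m)"
    unfolding p_def using k
    by (subst sum.group[symmetric, where g = "\<lambda>x. x ! k" and T = "set (weights ?j)"])
      (auto simp: basis_iff)
  also have "\<dots> = of_nat (spin_dim ?j) * p (- ?j)"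
    using eq by (simp add: distinct_card[OF distinct_weights] length_weights)
  finally have "p (- ?j) = 1 / of_nat (spin_dim ?j)"
    using spin_dim_eq(3)[OF j] by (simp add: field_simps)
  then show ?thesis using eq[OF m] unfolding p_def by simp
qed

lemma nths_singleton: "k < length xs \<Longrightarrow> nths xs {k} = [xs ! k]"
proof (induction xs arbitrary: k)
  case (Cons x xs)
  have "{i. Suc i \<in> {k}} = (if k = 0 then {} else {k - 1})" by auto
  then show ?case using Cons by (auto simp: nths_Cons)
qed simp

text \<open>Serves to compare two lists of total weight zero: if they agree off A, their weights on
  A have equal sums. This removes the off-diagonal entries of a one-site reduced density
  matrix.\<close>

lemma sum_list_nths_compl: "sum_list xs = sum_list (nths xs A) + sum_list (nths xs (- A))"
  for xs :: "real list"
proof (induction xs arbitrary: A)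
  case (Cons x xs)
  have "{j. Suc j \<in> - A} = - {j. Suc j \<in> A}" by auto
  then show ?case using Cons[of "{j. Suc j \<in> A}"] by (simp add: nths_Cons)
qed simp

lemma nths_compl_singleton_eq_imp_eq:
  assumes "length xs = length ys" "nths xs (- {k}) = nths ys (- {k})" "xs ! k = ys ! k"
  shows "xs = ys"
  using assms
proof (induction xs ys arbitrary: k rule: list_induct2)
  case (Cons x xs y ys)
  show ?case
  proof (cases k)
    case 0
    then have "{j. Suc j \<in> - {k}} = UNIV" by auto
    then show ?thesis using Cons.prems 0 by (simp add: nths_Cons nths_all)
  next
    case (Suc n)
    then have "{j. Suc j \<in> - {k}} = - {n}" by auto
    then show ?thesis using Cons.prems Cons.IH[of n] Suc by (simp add: nths_Cons)
  qed
qed simp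

lemma reduced_density_invariant:
  assumes js: "set js \<subseteq> spins" and \<psi>: "\<psi> \<in> invariant_space js" "unit_vector js \<psi>"
    and k: "k < length js"
  shows "reduced_density js {k} \<psi> = of_real (1 / (2 * js ! k + 1)) \<cdot>\<^sub>m 1\<^sub>m (spin_dim (js ! k))"
proof -
  let ?j = "js ! k" and ?B = "set (basis js)"
  have j: "?j \<in> spins" using js k by auto
  have b: "basis (nths js {k}) = map (\<lambda>m. [m]) (weights ?j)"
    using k by (simp add: nths_singleton basis_def concat_map_singleton)
  have entry: "(\<Sum>(x, y) \<in> {(x, y). x \<in> ?B \<and> y \<in> ?B \<and> nths x {k} = [m] \<and> nths y {k} = [m'] \<and>
        nths x (- {k}) = nths y (- {k})}. \<psi> x * cnj (\<psi> y)) =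
      (if m = m' then 1 / of_nat (spin_dim ?j) else 0)" (is "sum _ ?S = _")
    if m: "m \<in> set (weights ?j)" for m m'
  proof (cases "m = m'")
    case True
    \<comment> \<open>On the diagonal the pair agrees at k and off k, so the double sum collapses to
      the probability of m.\<close>
    have "x \<in> ?B \<and> y \<in> ?B \<and> nths x {k} = [m] \<and> nths y {k} = [m'] \<and> nths x (- {k}) = nths y (- {k})
        \<longleftrightarrow> x = y \<and> x \<in> ?B \<and> x ! k = m" for x y
    proof (cases "x \<in> ?B \<and> y \<in> ?B")
      case B: True
      then have "length x = length y" "nths x {k} = [x ! k]" "nths y {k} = [y ! k]"
        using k by (auto simp: basis_iff nths_singleton)
      then show ?thesis using True B by (metis list.inject nths_compl_singleton_eq_imp_eq)
    qed auto
    then have "?S = {(x, y). x = y \<and> x \<in> ?B \<and> x ! k = m}" by presburger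
    also have "\<dots> = (\<lambda>x. (x, x)) ` {x. x \<in> ?B \<and> x ! k = m}" by auto
    finally have "?S = (\<lambda>x. (x, x)) ` {x. x \<in> ?B \<and> x ! k = m}" .
    from this have "(\<Sum>(x, y) \<in> ?S. \<psi> x * cnj (\<psi> y)) = (\<Sum>x | x \<in> ?B \<and> x ! k = m. \<psi> x * cnj (\<psi> x))"
      by (simp add: sum.reindex inj_on_def)
    then show ?thesis using invariant_site_weight[OF js \<psi> k m] True by simp
  next
    case False
    \<comment> \<open>A nonzero product needs both total weights to be zero; agreement off k would
      then force m = m'.\<close>
    have "\<psi> x * cnj (\<psi> y) = 0" if "(x, y) \<in> ?S" for x y
    proof (rule ccontr)
      assume "\<psi> x * cnj (\<psi> y) \<noteq> 0"
      then have "sum_list x = 0" "sum_list y = 0"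
        using invariant_weight_zero[OF \<psi>(1)] by auto
      then show False
        using that False sum_list_nths_compl[of x "{k}"] sum_list_nths_compl[of y "{k}"] by simp
    qed
    then show ?thesis using False by (auto intro!: sum.neutral)
  qed
  have mem: "weights ?j ! r \<in> set (weights ?j)" if "r < spin_dim ?j" for r
    using that by (simp add: length_weights)
  have d: "complex_of_real (1 / (2 * ?j + 1)) = 1 / of_nat (spin_dim ?j)"
    unfolding spin_dim_eq(1)[OF j, symmetric] by simp
  show ?thesis
    unfolding reduced_density_def b Let_def d
    using entry[OF mem]
    by (intro eq_matI) (auto simp: length_weights nth_eq_iff_index_eq[OF distinct_weights])
qed


section \<open>Uniqueness of three-site invariant vectors\<close>

lemma basis2_iff: "[m1, m2] \<in> set (basis [j1, j2]) \<longleftrightarrow> m1 \<in> set (weights j1) \<and> m2 \<in> set (weights j2)"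
  by (auto simp: basis_iff All_less_Suc2)

lemma basis3_iff: "[m1, m2, m3] \<in> set (basis [j1, j2, j3]) \<longleftrightarrow>
    m1 \<in> set (weights j1) \<and> m2 \<in> set (weights j2) \<and> m3 \<in> set (weights j3)"
  by (auto simp: basis_iff All_less_Suc2)

lemma basis2E:
  assumes "ms \<in> set (basis [j1, j2])"
  obtains m1 m2 where "ms = [m1, m2]" "m1 \<in> set (weights j1)" "m2 \<in> set (weights j2)"
proof -
  have "length ms = Suc (Suc 0)" using assms by (simp add: basis_iff)
  then obtain m1 m2 where "ms = [m1, m2]" by (auto simp: length_Suc_conv)
  with assms that show thesis by (simp add: basis2_iff)
qed

lemma basis3E:
  assumes "ms \<in> set (basis [j1, j2, j3])"
  obtains m1 m2 m3 where "ms = [m1, m2, m3]"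
    "m1 \<in> set (weights j1)" "m2 \<in> set (weights j2)" "m3 \<in> set (weights j3)"
proof -
  have "length ms = Suc (Suc (Suc 0))" using assms by (simp add: basis_iff)
  then obtain m1 m2 m3 where "ms = [m1, m2, m3]" by (auto simp: length_Suc_conv)
  with assms that show thesis by (simp add: basis3_iff)
qed

lemma weights_extreme:
  assumes "j \<in> spins"
  shows "j \<in> set (weights j)" "- j \<in> set (weights j)"
  using spin_dim_eq(2)[OF assms] assms
  by (auto simp: weight_iff[OF assms] spins_def elim!: Nats_cases)

lemma weights_from_bottom:
  assumes "m \<in> set (weights j)"
  obtains n :: nat where "m = - j + n"
  using assms unfolding weights_def by auto

lemma weights_from_top:
  assumes "j \<in> spins" "m \<in> set (weights j)"
  obtains n :: nat where "m = j - n"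
  using weights_from_bottom[OF weights_uminus[OF assms]] by (metis minus_add_distrib minus_minus diff_conv_add_uminus)

lemma invariant3_plus:
  assumes "\<psi> \<in> invariant_space [j1, j2, j3]" "[m1, m2, m3] \<in> set (basis [j1, j2, j3])"
  shows "of_real (ladder_coeff j1 m1) * \<psi> [m1 - 1, m2, m3] + of_real (ladder_coeff j2 m2) * \<psi> [m1, m2 - 1, m3]
    + of_real (ladder_coeff j3 m3) * \<psi> [m1, m2, m3 - 1] = 0"
proof -
  have "total_op spin_plus [j1, j2, j3] \<psi> [m1, m2, m3] = 0"
    using assms(1) by (simp add: invariant_space_iff)
  then show ?thesis
    using total_op_spin_plus[OF _ assms(2), of \<psi>] assms(1)
    by (simp add: invariant_space_iff lessThan_Suc ac_simps)
qed

lemma invariant3_minus: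
  assumes "\<psi> \<in> invariant_space [j1, j2, j3]" "[m1, m2, m3] \<in> set (basis [j1, j2, j3])"
  shows "of_real (ladder_coeff j1 (m1 + 1)) * \<psi> [m1 + 1, m2, m3]
    + of_real (ladder_coeff j2 (m2 + 1)) * \<psi> [m1, m2 + 1, m3]
    + of_real (ladder_coeff j3 (m3 + 1)) * \<psi> [m1, m2, m3 + 1] = 0"
proof -
  have "total_op spin_minus [j1, j2, j3] \<psi> [m1, m2, m3] = 0"
    using assms(1) by (simp add: invariant_space_iff)
  then show ?thesis
    using total_op_spin_minus[OF _ assms(2), of \<psi>] assms(1)
    by (simp add: invariant_space_iff lessThan_Suc ac_simps)
qed

text \<open>Two recursions, each solved by dividing by a positive ladder coefficient: J_+ moves
  along m1 inside the lowest slice of m3, then J_- passes from one slice to the next. Total weight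
  zero fixes m2 in the lowest slice.\<close>

lemma invariant3_eq_zero:
  assumes j: "j1 \<in> spins" "j2 \<in> spins" "j3 \<in> spins"
    and inv: "\<psi> \<in> invariant_space [j1, j2, j3]" and top: "\<psi> [j1, j3 - j1, - j3] = 0"
  shows "\<psi> = 0"
proof -
  have out: "\<psi> ms = 0" if "ms \<notin> set (basis [j1, j2, j3])" for ms
    using that inv by (simp add: invariant_space_iff tensor_space_iff)
  have bottom: "\<psi> [j1 - real n, j3 - j1 + real n, - j3] = 0" for n
  proof (induction n)
    case (Suc n)
    show ?case
    proof (cases "[j1 - real (Suc n), j3 - j1 + real (Suc n), - j3] \<in> set (basis [j1, j2, j3])")
      case True
      then have mem: "j1 - real (Suc n) \<in> set (weights j1)"
        "j3 - j1 + real (Suc n) \<in> set (weights j2)" "- j3 \<in> set (weights j3)"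
        by (auto simp: basis3_iff)
      have "- j1 \<le> j1 - real (Suc n)" using mem(1) weight_iff[OF j(1)] by blast
      then have "0 < ladder_coeff j1 (j1 - real n)" by (intro ladder_coeff_pos) auto
      moreover have "j1 - real n \<in> set (weights j1)"
        using weights_succ[OF j(1) mem(1)] by simp
      then have "[j1 - real n, j3 - j1 + real (Suc n), - j3] \<in> set (basis [j1, j2, j3])"
        using mem by (simp add: basis3_iff)
      \<comment> \<open>The third term drops out because \<open>ladder_coeff j3 (- j3)\<close> is 0,
        and the second is the induction hypothesis.\<close>
      from invariant3_plus[OF inv this]
      have "of_real (ladder_coeff j1 (j1 - real n)) * \<psi> [j1 - real (Suc n), j3 - j1 + real (Suc n), - j3] = 0"
        using Suc by (simp add: algebra_simps)
      ultimately show ?thesis by simp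
    qed (rule out)
  qed (use top in simp)
  have slices: "\<psi> [m1, m2, - j3 + real n] = 0" for n m1 m2
  proof (induction n arbitrary: m1 m2)
    case 0
    show ?case
    proof (rule ccontr)
      assume nz: "\<psi> [m1, m2, - j3 + real 0] \<noteq> 0"
      then have "[m1, m2, - j3 + real 0] \<in> set (basis [j1, j2, j3])" using out by blast
      then have "m1 \<in> set (weights j1)" by (simp add: basis3_iff)
      then obtain n where m1: "m1 = j1 - real n" using weights_from_top[OF j(1)] by blast
      have "m2 = j3 - j1 + real n" using invariant_weight_zero[OF inv nz] m1 by simp
      with nz m1 bottom[of n] show False by simp
    qed
  next
    case (Suc n)
    show ?case
    proof (cases "[m1, m2, - j3 + real (Suc n)] \<in> set (basis [j1, j2, j3])")
      case True
      then have mem: "m1 \<in> set (weights j1)" "m2 \<in> set (weights j2)" "- j3 + real (Suc n) \<in> set (weights j3)"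
        by (auto simp: basis3_iff)
      have "- j3 + real (Suc n) \<le> j3" using mem(3) weight_iff[OF j(3)] by blast
      then have "0 < ladder_coeff j3 (- j3 + real (Suc n))" by (intro ladder_coeff_pos) auto
      moreover have "- j3 + real n \<in> set (weights j3)"
        using weights_pred[OF j(3) mem(3)] by simp
      then have "[m1, m2, - j3 + real n] \<in> set (basis [j1, j2, j3])"
        using mem by (simp add: basis3_iff)
      \<comment> \<open>Read at a list of slice n, the first two terms stay in that slice and
        vanish; only the term in slice n + 1 survives.\<close>
      from invariant3_minus[OF inv this]
      have "of_real (ladder_coeff j3 (- j3 + real (Suc n))) * \<psi> [m1, m2, - j3 + real (Suc n)] = 0"
        using Suc by (simp add: algebra_simps)
      ultimately show ?thesis by simp
    qed (rule out)
  qed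
  show ?thesis
  proof
    fix ms
    show "\<psi> ms = 0 ms"
    proof (cases "ms \<in> set (basis [j1, j2, j3])")
      case True
      then obtain m1 m2 m3 where "ms = [m1, m2, m3]" "m3 \<in> set (weights j3)" by (rule basis3E)
      then show ?thesis using slices by (metis weights_from_bottom zero_fun_apply)
    qed (simp add: out)
  qed
qed

interpretation states: vector_space cscale
  by (rule vector_space_cscale)

lemma subspace_invariant_space: "states.subspace (invariant_space js)"
  by (auto simp: states.subspace_def invariant_space_iff tensor_space_add tensor_space_cscale
      tensor_space_zero total_op_add total_op_cscale total_op_zero)


section \<open>Lowering a highest weight vector\<close>

text \<open>The coordinate formulas for total operators hold at basis lists only. When operators are
  composed, a shifted list may leave the basis, but then the coefficient in front is zero.\<close>

lemma site_ladder_cong: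
  assumes "set js \<subseteq> spins" "ms \<in> set (basis js)" "i < length js"
    and "ms[i := ms ! i - 1] \<in> set (basis js) \<Longrightarrow> x = y"
  shows "of_real (ladder_coeff (js ! i) (ms ! i)) * x = of_real (ladder_coeff (js ! i) (ms ! i)) * (y :: complex)"
proof (cases "ms ! i = - (js ! i)")
  case False
  have "js ! i \<in> spins" "ms ! i \<in> set (weights (js ! i))" using assms by (auto simp: basis_iff)
  then have "ms[i := ms ! i - 1] \<in> set (basis js)"
    using False assms(3) weights_pred by (simp add: basis_update_iff[OF assms(2)])
  then show ?thesis using assms(4) by simp
qed simp

lemma site_ladder_cong':
  assumes "set js \<subseteq> spins" "ms \<in> set (basis js)" "i < length js"
    and "ms[i := ms ! i + 1] \<in> set (basis js) \<Longrightarrow> x = y"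
  shows "of_real (ladder_coeff (js ! i) (ms ! i + 1)) * x =
    of_real (ladder_coeff (js ! i) (ms ! i + 1)) * (y :: complex)"
proof (cases "ms ! i = js ! i")
  case False
  have "js ! i \<in> spins" "ms ! i \<in> set (weights (js ! i))" using assms by (auto simp: basis_iff)
  then have "ms[i := ms ! i + 1] \<in> set (basis js)"
    using False assms(3) weights_succ by (simp add: basis_update_iff[OF assms(2)])
  then show ?thesis using assms(4) by simp
qed simp

lemma spin_plus_minus_commutator:
  assumes js: "set js \<subseteq> spins" and \<psi>: "\<psi> \<in> tensor_space js"
  shows "total_op spin_plus js (total_op spin_minus js \<psi>) =
    total_op spin_minus js (total_op spin_plus js \<psi>) + cscale 2 (total_op spin_z js \<psi>)"
proof
  fix x
  let ?n = "length js"
  define a where "a i m = complex_of_real (ladder_coeff (js ! i) m)" for i m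
  show "total_op spin_plus js (total_op spin_minus js \<psi>) x =
    (total_op spin_minus js (total_op spin_plus js \<psi>) + cscale 2 (total_op spin_z js \<psi>)) x"
  proof (cases "x \<in> set (basis js)")
    case x: True
    then have len: "length x = ?n" by (simp add: basis_iff)
    \<comment> \<open>\<open>T i l\<close> and \<open>U i l\<close> both raise at site i and lower
      at site l, in opposite orders. They coincide for different sites, and for i = l they differ by
      the one-site commutator.\<close>
    define T where "T i l = a i (x ! i) * (a l (x[i := x ! i - 1] ! l + 1) *
      \<psi> (x[i := x ! i - 1, l := x[i := x ! i - 1] ! l + 1]))" for i l
    define U where "U i l = a l (x ! l + 1) * (a i (x[l := x ! l + 1] ! i) *
      \<psi> (x[l := x ! l + 1, i := x[l := x ! l + 1] ! i - 1]))" for i l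
    have "total_op spin_plus js (total_op spin_minus js \<psi>) x =
        (\<Sum>i<?n. a i (x ! i) * total_op spin_minus js \<psi> (x[i := x ! i - 1]))"
      unfolding a_def by (rule total_op_spin_plus[OF total_op_tensor_space x])
    also have "\<dots> = (\<Sum>i<?n. a i (x ! i) * (\<Sum>l<?n. a l (x[i := x ! i - 1] ! l + 1) *
        \<psi> (x[i := x ! i - 1, l := x[i := x ! i - 1] ! l + 1])))"
      unfolding a_def
      by (intro sum.cong refl site_ladder_cong[OF js x] total_op_spin_minus[OF \<psi>]) auto
    finally have PM: "total_op spin_plus js (total_op spin_minus js \<psi>) x = (\<Sum>i<?n. \<Sum>l<?n. T i l)"
      by (simp add: T_def sum_distrib_left)
    have "total_op spin_minus js (total_op spin_plus js \<psi>) x =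
        (\<Sum>l<?n. a l (x ! l + 1) * total_op spin_plus js \<psi> (x[l := x ! l + 1]))"
      unfolding a_def by (rule total_op_spin_minus[OF total_op_tensor_space x])
    also have "\<dots> = (\<Sum>l<?n. a l (x ! l + 1) * (\<Sum>i<?n. a i (x[l := x ! l + 1] ! i) *
        \<psi> (x[l := x ! l + 1, i := x[l := x ! l + 1] ! i - 1])))"
      unfolding a_def
      by (intro sum.cong refl site_ladder_cong'[OF js x] total_op_spin_plus[OF \<psi>]) auto
    also have "\<dots> = (\<Sum>l<?n. \<Sum>i<?n. U i l)"
      by (simp add: U_def sum_distrib_left)
    also have "\<dots> = (\<Sum>i<?n. \<Sum>l<?n. U i l)"
      by (rule sum.swap)
    finally have MP: "total_op spin_minus js (total_op spin_plus js \<psi>) x = (\<Sum>i<?n. \<Sum>l<?n. U i l)" .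
    have TU: "T i l = U i l + (if l = i then of_real (2 * x ! i) * \<psi> x else 0)"
      if i: "i < ?n" for i l
    proof (cases "l = i")
      case True
      have "x ! i \<in> set (weights (js ! i))" "js ! i \<in> spins" using x i js by (auto simp: basis_iff)
      then have "(ladder_coeff (js ! i) (x ! i))\<^sup>2 = (ladder_coeff (js ! i) (x ! i + 1))\<^sup>2 + 2 * x ! i"
        using ladder_coeff_square_diff weight_iff by (metis diff_eq_eq add.commute)
      then have "a i (x ! i) * a i (x ! i) = a i (x ! i + 1) * a i (x ! i + 1) + of_real (2 * x ! i)"
        unfolding a_def power2_eq_square of_real_mult[symmetric] of_real_add[symmetric] by simp
      moreover have "T i i = (a i (x ! i) * a i (x ! i)) * \<psi> x"
        "U i i = (a i (x ! i + 1) * a i (x ! i + 1)) * \<psi> x"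
        using i len by (simp_all add: T_def U_def)
      ultimately show ?thesis using True by (simp add: distrib_right)
    next
      case False
      then show ?thesis by (simp add: T_def U_def list_update_swap)
    qed
    have "(\<Sum>i<?n. \<Sum>l<?n. T i l) =
        (\<Sum>i<?n. (\<Sum>l<?n. U i l) + of_real (2 * x ! i) * \<psi> x)"
      using TU by (intro sum.cong refl) (simp add: sum.distrib)
    also have "\<dots> = (\<Sum>i<?n. \<Sum>l<?n. U i l) + 2 * (of_real (sum_list x) * \<psi> x)"
      by (simp add: sum.distrib sum_list_sum_nth len atLeast0LessThan sum_distrib_left sum_distrib_right
          mult.assoc)
    finally show ?thesis by (simp add: PM MP total_op_spin_z[OF \<psi>])
  next
    case False
    then show ?thesis
      using total_op_tensor_space[of _ js] by (simp add: tensor_space_iff)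
  qed
qed

lemma sum_list_update_group:
  "i < length xs \<Longrightarrow> sum_list (xs[i := x]) = sum_list xs - xs ! i + (x :: 'a :: ab_group_add)"
  by (induction xs arbitrary: i) (auto simp: nth_Cons split: nat.split)

lemma spin_minus_weight:
  assumes \<psi>: "\<psi> \<in> tensor_space js" and w: "\<And>ms. \<psi> ms \<noteq> 0 \<Longrightarrow> sum_list ms = w"
    and nz: "total_op spin_minus js \<psi> ms \<noteq> 0"
  shows "sum_list ms = w - 1"
proof -
  have b: "ms \<in> set (basis js)"
    using nz total_op_tensor_space[of spin_minus js \<psi>] by (auto simp: tensor_space_iff)
  from nz obtain i where i: "i < length js" "\<psi> (ms[i := ms ! i + 1]) \<noteq> 0"
    unfolding total_op_spin_minus[OF \<psi> b] by (metis (no_types, lifting) lessThan_iff mult_zero_right sum.neutral)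
  have "sum_list (ms[i := ms ! i + 1]) = sum_list ms + 1"
    using i(1) b sum_list_update_group[of i ms] by (simp add: basis_iff)
  then show ?thesis using w[OF i(2)] by simp
qed

lemma total_op_spin_z_eq_cscale:
  assumes "\<psi> \<in> tensor_space js" "\<And>ms. \<psi> ms \<noteq> 0 \<Longrightarrow> sum_list ms = w"
  shows "total_op spin_z js \<psi> = cscale (of_real w) \<psi>"
  using assms(2) by (auto simp: total_op_spin_z[OF assms(1)] fun_eq_iff)

text \<open>Keeps the whole ladder real, so that \<open>Re\<close> in \<open>clebsch_gordan\<close>
  loses nothing.\<close>

lemma spin_minus_real:
  assumes \<psi>: "\<psi> \<in> tensor_space js" and "\<And>ms. \<psi> ms \<in> \<real>"
  shows "total_op spin_minus js \<psi> ms \<in> \<real>"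
proof (cases "ms \<in> set (basis js)")
  case True
  then show ?thesis using assms(2) by (simp add: total_op_spin_minus[OF \<psi>] sum_in_Reals)
next
  case False
  then show ?thesis using total_op_tensor_space[of spin_minus js \<psi>] by (simp add: tensor_space_iff)
qed

lemma state_inner_self: "state_inner js \<psi> \<psi> = of_real (\<Sum>ms\<in>set (basis js). (cmod (\<psi> ms))\<^sup>2)"
  unfolding state_inner_def of_real_sum complex_norm_square ..

lemma state_inner_self_eq_0:
  assumes "\<psi> \<in> tensor_space js" "state_inner js \<psi> \<psi> = 0"
  shows "\<psi> = 0"
proof
  fix ms
  have "\<forall>ms\<in>set (basis js). (cmod (\<psi> ms))\<^sup>2 = 0"
    using assms(2) unfolding state_inner_self of_real_eq_0_iff
    by (subst (asm) sum_nonneg_eq_0_iff) auto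
  then show "\<psi> ms = 0 ms" using assms(1) by (cases "ms \<in> set (basis js)") (auto simp: tensor_space_iff)
qed

lemma unit_vector_iff: "unit_vector js \<psi> \<longleftrightarrow> \<psi> \<in> tensor_space js \<and> state_inner js \<psi> \<psi> = 1"
  unfolding unit_vector_def state_inner_self by (simp only: of_real_eq_1_iff)

lemma state_inner_commute: "state_inner js \<psi> \<phi> = cnj (state_inner js \<phi> \<psi>)"
  unfolding state_inner_def by (simp add: mult.commute)

lemma state_inner_cscale:
  "state_inner js (cscale c \<phi>) \<psi> = c * state_inner js \<phi> \<psi>"
  "state_inner js \<phi> (cscale c \<psi>) = cnj c * state_inner js \<phi> \<psi>"
  unfolding state_inner_def by (simp_all add: sum_distrib_left ac_simps)

lemma spin_minus_adjoint:
  assumes "set js \<subseteq> spins" "\<phi> \<in> tensor_space js" "\<psi> \<in> tensor_space js"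
  shows "state_inner js (total_op spin_minus js \<phi>) \<psi> = state_inner js \<phi> (total_op spin_plus js \<psi>)"
  using spin_plus_adjoint[OF assms(1,3,2)] by (metis state_inner_commute)

text \<open>Each step divides by the coefficient that J_- should produce, so that
  \<open>lowered js J \<psi> k\<close> is the candidate for |J, J - k>. At k = 2 J that coefficient
  is 0, and division by zero continues the sequence with 0.\<close>

fun lowered :: "real list \<Rightarrow> real \<Rightarrow> state \<Rightarrow> nat \<Rightarrow> state" where
  "lowered js J \<psi> 0 = \<psi>"
| "lowered js J \<psi> (Suc k) =
    cscale (1 / of_real (ladder_coeff J (J - real k))) (total_op spin_minus js (lowered js J \<psi> k))"

declare lowered.simps(2) [simp del]

locale highest_weight_state =
  fixes js :: "real list" and J :: real and \<psi> :: state
  assumes js: "set js \<subseteq> spins" and J: "J \<in> spins"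
    and unit: "unit_vector js \<psi>"
    and weight: "\<And>ms. \<psi> ms \<noteq> 0 \<Longrightarrow> sum_list ms = J"
    and raise: "total_op spin_plus js \<psi> = 0"
    and real: "\<And>ms. \<psi> ms \<in> \<real>"
begin

abbreviation u where "u \<equiv> lowered js J \<psi>"

text \<open>The matrix element <J, J-k-1| J_- |J, J-k>, that is, the coefficient for leaving
  \<open>u k\<close> downwards.\<close>

abbreviation s where "s k \<equiv> complex_of_real (ladder_coeff J (J - real k))"

lemma tensor: "u k \<in> tensor_space js"
  using unit by (cases k) (simp_all add: lowered.simps unit_vector_def tensor_space_cscale total_op_tensor_space)

lemma real_u: "u k ms \<in> \<real>"
  by (induction k arbitrary: ms) (simp_all add: lowered.simps real spin_minus_real[OF tensor])

lemma weight_u: "u k ms \<noteq> 0 \<Longrightarrow> sum_list ms = J - real k"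
proof (induction k arbitrary: ms)
  case (Suc k)
  then have "total_op spin_minus js (u k) ms \<noteq> 0" by (auto simp: lowered.simps)
  from spin_minus_weight[OF tensor Suc.IH this] show ?case by simp
qed (use weight in simp)

lemma s_nonzero: "real k < 2 * J \<Longrightarrow> s k \<noteq> 0"
  using ladder_coeff_pos[of J "J - real k"] by simp

lemma minus_u: "real k < 2 * J \<Longrightarrow> total_op spin_minus js (u k) = cscale (s k) (u (Suc k))"
  using s_nonzero[of k] by (simp add: lowered.simps)

text \<open>The conditional guards against truncated subtraction: at k = 0 the preceding coefficient
  is \<open>ladder_coeff J (J + 1)\<close> = 0, whereas \<open>s (0 - 1)\<close> would be
  \<open>s 0\<close>.\<close>

lemma s_square_diff:
  assumes "real k \<le> 2 * J"
  shows "s k * s k - (if k = 0 then 0 else s (k - 1) * s (k - 1)) = 2 * of_real (J - real k)"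
proof -
  have "(ladder_coeff J (J - real k))\<^sup>2 - (ladder_coeff J (J - real k + 1))\<^sup>2 = 2 * (J - real k)"
    using assms by (intro ladder_coeff_square_diff) auto
  moreover have "ladder_coeff J (J - real k + 1) = (if k = 0 then 0 else ladder_coeff J (J - real (k - 1)))"
    using ladder_coeff_boundary(2)[of J] by (cases k) (simp_all add: algebra_simps)
  ultimately have "(ladder_coeff J (J - real k))\<^sup>2 -
      (if k = 0 then 0 else (ladder_coeff J (J - real (k - 1)))\<^sup>2) = 2 * (J - real k)"
    by (simp split: if_splits)
  from arg_cong[OF this, of complex_of_real] show ?thesis
    by (cases "k = 0") (simp_all add: power2_eq_square)
qed

text \<open>The two claims feed each other: the commutator turns the first at k into the second at
  k, with eigenvalue s(k-1)^2 + 2 (J - k) = s(k)^2, and dividing by \<open>s k\<close> gives the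
  first at k + 1. The second still holds at k = 2 J, which is what ends the ladder.\<close>

lemma plus_u_and_plus_minus_u:
  assumes "real k \<le> 2 * J"
  shows "total_op spin_plus js (u k) = (if k = 0 then 0 else cscale (s (k - 1)) (u (k - 1)))"
    and "total_op spin_plus js (total_op spin_minus js (u k)) = cscale (s k * s k) (u k)"
proof -
  have step: "total_op spin_plus js (total_op spin_minus js (u k)) = cscale (s k * s k) (u k)"
    if k: "real k \<le> 2 * J"
      and IH: "total_op spin_plus js (u k) = (if k = 0 then 0 else cscale (s (k - 1)) (u (k - 1)))" for k
  proof -
    have "total_op spin_minus js (total_op spin_plus js (u k)) =
        cscale (if k = 0 then 0 else s (k - 1) * s (k - 1)) (u k)"
    proof (cases k)
      case (Suc n)
      then have "real n < 2 * J" using k by simp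
      note minus_u[OF this]
      moreover have "total_op spin_plus js (u k) = cscale (s n) (u n)" using IH Suc by simp
      ultimately show ?thesis using Suc by (simp add: total_op_cscale)
    next
      case 0
      then show ?thesis using IH by (simp add: total_op_zero)
    qed
    moreover have "total_op spin_z js (u k) = cscale (of_real (J - real k)) (u k)"
      by (rule total_op_spin_z_eq_cscale[OF tensor weight_u])
    ultimately show ?thesis
      unfolding spin_plus_minus_commutator[OF js tensor]
      using s_square_diff[OF k] by (simp add: fun_eq_iff algebra_simps del: of_real_diff split del: if_split)
  qed
  show 1: "total_op spin_plus js (u k) = (if k = 0 then 0 else cscale (s (k - 1)) (u (k - 1)))"
    using assms
  proof (induction k)
    case (Suc k)
    have "total_op spin_plus js (u (Suc k)) = cscale (1 / s k) (cscale (s k * s k) (u k))"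
      unfolding lowered.simps total_op_cscale using Suc by (subst step) auto
    then show ?case using s_nonzero[of k] Suc.prems by simp
  qed (simp add: raise)
  show "total_op spin_plus js (total_op spin_minus js (u k)) = cscale (s k * s k) (u k)"
    using assms 1 by (rule step)
qed

lemma inner_minus_u:
  assumes "real k \<le> 2 * J"
  shows "state_inner js (total_op spin_minus js (u k)) (total_op spin_minus js (u k)) =
    s k * s k * state_inner js (u k) (u k)"
  by (simp add: spin_minus_adjoint[OF js tensor total_op_tensor_space] plus_u_and_plus_minus_u(2)[OF assms]
      state_inner_cscale)

lemma unit_u: "real k \<le> 2 * J \<Longrightarrow> unit_vector js (u k)"
proof (induction k)
  case (Suc k)
  then have "state_inner js (u (Suc k)) (u (Suc k)) = 1"
    using s_nonzero[of k] by (simp add: lowered.simps(2) state_inner_cscale inner_minus_u unit_vector_iff)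
  then show ?case using tensor unfolding unit_vector_iff by blast
qed (simp add: unit)

lemma minus_bottom:
  assumes "real k = 2 * J"
  shows "total_op spin_minus js (u k) = 0"
proof (rule state_inner_self_eq_0[OF total_op_tensor_space])
  have "s k = 0" using assms ladder_coeff_boundary(1)[of J] by simp
  then show "state_inner js (total_op spin_minus js (u k)) (total_op spin_minus js (u k)) = 0"
    using assms by (simp add: inner_minus_u)
qed

end


section \<open>Existence of the coupled basis\<close>

text \<open>The triangle inequalities bound J - j1 by - j2 and j2, so the coordinate in the
  Condon-Shortley condition belongs to the basis.\<close>

lemma triad_weight:
  assumes "triad j1 j2 J"
  shows "J - j1 \<in> set (weights j2)"
proof -
  have j: "j1 \<in> spins" "j2 \<in> spins" "j1 + j2 + J \<in> \<int>" using assms by (auto simp: triad_def)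
  have "2 * j1 \<in> \<int>" using j(1) by (auto simp: spins_def elim: Nats_cases)
  from Ints_diff[OF j(3) this] have "J - j1 + j2 \<in> \<int>" by (simp add: algebra_simps)
  then show ?thesis using assms unfolding weight_iff[OF j(2)] triad_def by auto
qed

text \<open>Solves \<open>J_+ \<psi> = 0\<close> for \<open>\<psi> = \<Sum>k. c k |j1, j1 - k> |j2, J - j1 + k>\<close>.\<close>

primrec top_coeff :: "real \<Rightarrow> real \<Rightarrow> real \<Rightarrow> nat \<Rightarrow> real" where
  "top_coeff j1 j2 J 0 = 1"
| "top_coeff j1 j2 J (Suc k) =
    - (ladder_coeff j2 (J - j1 + real k + 1) / ladder_coeff j1 (j1 - real k)) * top_coeff j1 j2 J k"

definition top_state :: "real \<Rightarrow> real \<Rightarrow> real \<Rightarrow> state" where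
  "top_state j1 j2 J ms = (if ms \<in> set (basis [j1, j2]) \<and> sum_list ms = J
     then of_real (top_coeff j1 j2 J (nat \<lfloor>j1 - ms ! 0\<rfloor>)) else 0)"

lemma top_state_tensor_space: "top_state j1 j2 J \<in> tensor_space [j1, j2]"
  by (simp add: tensor_space_iff top_state_def)

lemma top_state_at:
  assumes "[j1 - real k, m2] \<in> set (basis [j1, j2])"
  shows "top_state j1 j2 J [j1 - real k, m2] =
    (if m2 = J - j1 + real k then of_real (top_coeff j1 j2 J k) else 0)"
  using assms by (auto simp: top_state_def)

lemma spin_plus_pair:
  assumes "\<psi> \<in> tensor_space [j1, j2]" "[m1, m2] \<in> set (basis [j1, j2])"
  shows "total_op spin_plus [j1, j2] \<psi> [m1, m2] =
    of_real (ladder_coeff j1 m1) * \<psi> [m1 - 1, m2] + of_real (ladder_coeff j2 m2) * \<psi> [m1, m2 - 1]"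
  using total_op_spin_plus[OF assms] by (simp add: lessThan_Suc ac_simps)

lemma spin_minus_pair:
  assumes "\<psi> \<in> tensor_space [j1, j2]" "[m1, m2] \<in> set (basis [j1, j2])"
  shows "total_op spin_minus [j1, j2] \<psi> [m1, m2] =
    of_real (ladder_coeff j1 (m1 + 1)) * \<psi> [m1 + 1, m2] + of_real (ladder_coeff j2 (m2 + 1)) * \<psi> [m1, m2 + 1]"
  using total_op_spin_minus[OF assms] by (simp add: lessThan_Suc ac_simps)

text \<open>J_+ sends the state to total weight J + 1, where each coordinate receives contributions
  from the coefficients k and k + 1 only; the recursion of \<open>top_coeff\<close> makes them
  cancel.\<close>

lemma spin_plus_top_state:
  assumes t: "triad j1 j2 J"
  shows "total_op spin_plus [j1, j2] (top_state j1 j2 J) = 0"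
proof
  fix ms
  have j: "j1 \<in> spins" "j2 \<in> spins" using t by (auto simp: triad_def)
  show "total_op spin_plus [j1, j2] (top_state j1 j2 J) ms = 0 ms"
  proof (cases "ms \<in> set (basis [j1, j2])")
    case False
    then show ?thesis
      using total_op_tensor_space[of spin_plus "[j1, j2]"] by (simp add: tensor_space_iff)
  next
    case True
    then obtain m1 m2 where ms: "ms = [m1, m2]" and m: "m1 \<in> set (weights j1)" "m2 \<in> set (weights j2)"
      by (rule basis2E)
    obtain k where k: "m1 = j1 - real k" using weights_from_top[OF j(1) m(1)] .
    have out: "top_state j1 j2 J ms' = 0" if "ms' \<notin> set (basis [j1, j2])" for ms'
      using that by (simp add: top_state_def)
    have 1: "of_real (ladder_coeff j2 m2) * top_state j1 j2 J [m1, m2 - 1] =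
        (if m1 + m2 = J + 1 then of_real (ladder_coeff j2 m2 * top_coeff j1 j2 J k) else 0)"
    proof (cases "m2 = - j2")
      case False
      then have "[m1, m2 - 1] \<in> set (basis [j1, j2])"
        using m weights_pred[OF j(2)] by (simp add: basis2_iff)
      then show ?thesis using k by (auto simp: top_state_at)
    qed simp
    have 2: "of_real (ladder_coeff j1 m1) * top_state j1 j2 J [m1 - 1, m2] =
        (if m1 + m2 = J + 1 then - of_real (ladder_coeff j2 m2 * top_coeff j1 j2 J k) else 0)"
    proof (cases "m1 = - j1")
      case True
      \<comment> \<open>By the triangle inequality the sum \<open>J + 1\<close> would force \<open>m2 > j2\<close>.\<close>
      have "m1 + m2 \<noteq> J + 1"
        using True t m(2) unfolding weight_iff[OF j(2)] triad_def by auto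
      then show ?thesis using True by simp
    next
      case False
      then have b: "[j1 - real (Suc k), m2] \<in> set (basis [j1, j2])"
        using m weights_pred[OF j(1) m(1)] k by (simp add: basis2_iff diff_diff_eq add.commute)
      have "- j1 \<le> m1" "m1 \<le> j1" using m(1) unfolding weight_iff[OF j(1)] by auto
      then have pos: "0 < ladder_coeff j1 (j1 - real k)"
        using False k by (intro ladder_coeff_pos) auto
      have "m1 - 1 = j1 - real (Suc k)" using k by simp
      then have "top_state j1 j2 J [m1 - 1, m2] =
          (if m1 + m2 = J + 1 then of_real (top_coeff j1 j2 J (Suc k)) else 0)"
        using k by (auto simp only: top_state_at[OF b]) auto
      moreover have "m1 + m2 = J + 1 \<Longrightarrow>
          ladder_coeff j1 m1 * top_coeff j1 j2 J (Suc k) = - (ladder_coeff j2 m2 * top_coeff j1 j2 J k)"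
      proof -
        assume "m1 + m2 = J + 1"
        then have "J - j1 + real k + 1 = m2" using k by simp
        then show ?thesis using pos unfolding k top_coeff.simps by simp
      qed
      then have "m1 + m2 = J + 1 \<Longrightarrow> of_real (ladder_coeff j1 m1) * of_real (top_coeff j1 j2 J (Suc k)) =
          - complex_of_real (ladder_coeff j2 m2 * top_coeff j1 j2 J k)"
        by (metis of_real_minus of_real_mult)
      ultimately show ?thesis by simp
    qed
    show ?thesis
      unfolding ms using 1 2 m by (simp add: spin_plus_pair[OF top_state_tensor_space] basis2_iff)
  qed
qed

text \<open>Reality is recorded along with existence, since it is needed to undo the
  \<open>Re\<close> in \<open>clebsch_gordan\<close>.\<close>

lemma ex_coupled_basis:
  assumes t: "triad j1 j2 J"
  shows "\<exists>\<Phi>. coupled_basis j1 j2 J \<Phi> \<and> (\<forall>M ms. \<Phi> M ms \<in> \<real>)"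
proof -
  have j: "j1 \<in> spins" "j2 \<in> spins" "J \<in> spins" using t by (auto simp: triad_def)
  let ?js = "[j1, j2]" and ?t = "top_state j1 j2 J"
  \<comment> \<open>Squared norm before normalisation. It is positive because the coordinate at k =
    0 is 1, and that same coordinate, divided by sqrt N, satisfies the phase condition.\<close>
  define N where "N = (\<Sum>ms\<in>set (basis ?js). (cmod (?t ms))\<^sup>2)"
  have top: "[j1 - real 0, J - j1] \<in> set (basis ?js)"
    using triad_weight[OF t] weights_extreme[OF j(1)] by (simp add: basis2_iff)
  have t1: "?t [j1, J - j1] = 1" using top_state_at[OF top, of J] by simp
  have "0 < N"
    unfolding N_def using top t1 by (intro sum_pos2[of _ "[j1, J - j1]"]) auto
  define \<psi> where "\<psi> = cscale (of_real (1 / sqrt N)) ?t"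
  have unit: "unit_vector ?js \<psi>"
    unfolding unit_vector_def \<psi>_def using \<open>0 < N\<close>
    by (simp add: tensor_space_cscale top_state_tensor_space norm_divide power_divide
        N_def[symmetric] flip: sum_divide_distrib)
  interpret highest_weight_state ?js J \<psi>
  proof
    show "\<psi> ms \<noteq> 0 \<Longrightarrow> sum_list ms = J" for ms
      by (auto simp: \<psi>_def top_state_def split: if_splits)
    show "total_op spin_plus ?js \<psi> = 0"
      by (simp add: \<psi>_def total_op_cscale spin_plus_top_state[OF t])
    show "\<psi> ms \<in> \<real>" for ms
      by (simp add: \<psi>_def top_state_def)
  qed (use j unit in auto)
  define \<Phi> where "\<Phi> M = (if M \<in> set (weights J) then u (nat \<lfloor>J - M\<rfloor>) else 0)" for M
  have \<Phi>: "\<Phi> (J - real k) = u k" if "J - real k \<in> set (weights J)" for k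
    using that by (simp add: \<Phi>_def)
  have "unit_vector ?js (\<Phi> M) \<and>
      total_op spin_z ?js (\<Phi> M) = cscale (of_real M) (\<Phi> M) \<and>
      total_op spin_plus ?js (\<Phi> M) = cscale (of_real (sqrt (J * (J + 1) - M * (M + 1)))) (\<Phi> (M + 1)) \<and>
      total_op spin_minus ?js (\<Phi> M) = cscale (of_real (sqrt (J * (J + 1) - M * (M - 1)))) (\<Phi> (M - 1))"
    if M: "M \<in> set (weights J)" for M
  proof -
    obtain k where k: "M = J - real k" using weights_from_top[OF j(3) M] .
    have le: "real k \<le> 2 * J" using M k unfolding weight_iff[OF j(3)] by auto
    have plus: "sqrt (J * (J + 1) - M * (M + 1)) = ladder_coeff J (M + 1)"
      and minus: "sqrt (J * (J + 1) - M * (M - 1)) = ladder_coeff J M"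
      by (simp_all add: ladder_coeff_def algebra_simps)
    have "total_op spin_plus ?js (u k) = cscale (of_real (ladder_coeff J (M + 1))) (\<Phi> (M + 1))"
    proof (cases k)
      case 0
      then show ?thesis using plus_u_and_plus_minus_u(1)[OF le] k by simp
    next
      case (Suc n)
      then have M1: "M + 1 = J - real n" using k by simp
      have "M \<noteq> J" using k Suc by simp
      then have "\<Phi> (M + 1) = u n"
        using \<Phi>[of n] weights_succ[OF j(3) M] unfolding M1 by blast
      then show ?thesis using plus_u_and_plus_minus_u(1)[OF le] M1 Suc by simp
    qed
    moreover have "total_op spin_minus ?js (u k) = cscale (of_real (ladder_coeff J M)) (\<Phi> (M - 1))"
    proof (cases "M = - J")
      case True
      then have "ladder_coeff J M = 0" by simp
      moreover have "total_op spin_minus ?js (u k) = 0"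
        using True k by (intro minus_bottom) simp
      ultimately show ?thesis by simp
    next
      case False
      have M1: "M - 1 = J - real (Suc k)" using k by simp
      have "\<Phi> (M - 1) = u (Suc k)"
        using \<Phi>[of "Suc k"] weights_pred[OF j(3) M False] unfolding M1 by blast
      moreover have "real k < 2 * J" using False k le by auto
      ultimately show ?thesis using minus_u k by simp
    qed
    ultimately show ?thesis
      unfolding plus minus
      using \<Phi>[of k] M unit_u[OF le] total_op_spin_z_eq_cscale[OF tensor weight_u, of k] k by simp
  qed
  moreover have "\<Phi> J [j1, J - j1] = of_real (1 / sqrt N)"
    using \<Phi>[of 0] weights_extreme[OF j(3)] t1 by (simp add: \<psi>_def)
  moreover have "\<Phi> M ms \<in> \<real>" for M ms
    by (simp add: \<Phi>_def real_u)
  ultimately have "coupled_basis j1 j2 J \<Phi> \<and> (\<forall>M ms. \<Phi> M ms \<in> \<real>)"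
    unfolding coupled_basis_def using \<open>0 < N\<close> by (auto simp: \<Phi>_def)
  then show ?thesis by blast
qed


section \<open>The three-j state\<close>

\<comment> \<open>Otherwise \<open>module.span\<close> would denote the span of \<open>VectorSpace.LinearCombinations\<close>.\<close>
hide_const LinearCombinations.module.span

definition coupled_triple :: "real \<Rightarrow> real \<Rightarrow> real \<Rightarrow> (real \<Rightarrow> state) \<Rightarrow> state" where
  "coupled_triple j1 j2 J \<Phi> ms = (if ms \<in> set (basis [j1, j2, J])
     then of_real ((-1) powi \<lfloor>j1 - j2 - ms ! 2\<rfloor> / sqrt (2 * J + 1)) * \<Phi> (- (ms ! 2)) [ms ! 0, ms ! 1] else 0)"

text \<open>Floor commutes with integer shifts, so neighbouring slices of the triple carry opposite
  signs.\<close>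

lemma floor_sign_shift:
  "(-1) powi \<lfloor>x - (m - 1)\<rfloor> = - ((-1) powi \<lfloor>x - m\<rfloor> :: real)"
  "(-1) powi \<lfloor>x - (m + 1)\<rfloor> = - ((-1) powi \<lfloor>x - m\<rfloor> :: real)"
proof -
  have eq: "\<lfloor>x - (m - 1)\<rfloor> = \<lfloor>x - m\<rfloor> + 1" "\<lfloor>x - m\<rfloor> = \<lfloor>x - (m + 1)\<rfloor> + 1"
    unfolding one_add_floor by (simp_all add: algebra_simps)
  have step: "(-1) powi (z + 1) = - ((-1) powi z :: real)" for z
    by (simp add: power_int_add_1)
  show "(-1) powi \<lfloor>x - (m - 1)\<rfloor> = - ((-1) powi \<lfloor>x - m\<rfloor> :: real)"
    unfolding eq(1) step ..
  show "(-1) powi \<lfloor>x - (m + 1)\<rfloor> = - ((-1) powi \<lfloor>x - m\<rfloor> :: real)"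
    unfolding eq(2) step by simp
qed

text \<open>The product formula also holds off the basis, because \<open>\<Phi>\<close> is zero
  outside the weights of J and its members vanish off their own basis. Shifted lists thus need no
  case distinction.\<close>

lemma coupled_triple_at:
  assumes t: "triad j1 j2 J" and c: "coupled_basis j1 j2 J \<Phi>"
  shows "coupled_triple j1 j2 J \<Phi> [m1, m2, m3] =
    of_real ((-1) powi \<lfloor>j1 - j2 - m3\<rfloor> / sqrt (2 * J + 1)) * \<Phi> (- m3) [m1, m2]"
proof (cases "[m1, m2, m3] \<in> set (basis [j1, j2, J])")
  case False
  have J: "J \<in> spins" using t by (simp add: triad_def)
  have "\<Phi> (- m3) [m1, m2] = 0"
  proof (cases "- m3 \<in> set (weights J)")
    case True
    then have "m3 \<in> set (weights J)" using weights_uminus[OF J True] by simp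
    then have "[m1, m2] \<notin> set (basis [j1, j2])" using False by (simp add: basis2_iff basis3_iff)
    then show ?thesis using c True by (simp add: coupled_basis_def unit_vector_def tensor_space_iff)
  qed (use c in \<open>simp add: coupled_basis_def\<close>)
  then show ?thesis using False by (simp add: coupled_triple_def)
qed (simp add: coupled_triple_def)

lemma coupled_triple_invariant:
  assumes t: "triad j1 j2 J" and c: "coupled_basis j1 j2 J \<Phi>"
  shows "coupled_triple j1 j2 J \<Phi> \<in> invariant_space [j1, j2, J]"
proof -
  let ?js = "[j1, j2, J]" and ?T = "coupled_triple j1 j2 J \<Phi>"
  have J: "J \<in> spins" using t by (simp add: triad_def)
  have T: "?T \<in> tensor_space ?js" by (simp add: tensor_space_iff coupled_triple_def)
  note at = coupled_triple_at[OF t c]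
  have "total_op spin_plus ?js ?T ms = 0 \<and> total_op spin_minus ?js ?T ms = 0 \<and> total_op spin_z ?js ?T ms = 0"
    for ms
  proof (cases "ms \<in> set (basis ?js)")
    case True
    then obtain m1 m2 m3 where ms: "ms = [m1, m2, m3]" and m: "m1 \<in> set (weights j1)"
      "m2 \<in> set (weights j2)" "m3 \<in> set (weights J)"
      by (rule basis3E)
    note b = True[unfolded ms]
    have b2: "[m1, m2] \<in> set (basis [j1, j2])" using m by (simp add: basis2_iff)
    have M: "- m3 \<in> set (weights J)" by (rule weights_uminus[OF J m(3)])
    note c\<Phi> = c[unfolded coupled_basis_def, THEN conjunct2, THEN conjunct1, rule_format, OF M]
    \<comment> \<open>Raising M = - m3 is lowering m3, and the coefficient is the same:
      \<open>ladder_coeff J (1 - m3)\<close> equals \<open>ladder_coeff J m3\<close>.\<close>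
    have sq: "sqrt (J * (J + 1) - - m3 * (- m3 + 1)) = ladder_coeff J m3"
      "sqrt (J * (J + 1) - - m3 * (- m3 - 1)) = ladder_coeff J (m3 + 1)"
      "- m3 + 1 = - (m3 - 1)" "- m3 - 1 = - (m3 + 1)"
      by (simp_all add: ladder_coeff_def algebra_simps)
    have \<Phi>: "\<Phi> (- m3) \<in> tensor_space [j1, j2]"
      and z: "total_op spin_z [j1, j2] (\<Phi> (- m3)) [m1, m2] = of_real (- m3) * \<Phi> (- m3) [m1, m2]"
      and plus: "total_op spin_plus [j1, j2] (\<Phi> (- m3)) [m1, m2] =
          of_real (ladder_coeff J m3) * \<Phi> (- (m3 - 1)) [m1, m2]"
      and minus: "total_op spin_minus [j1, j2] (\<Phi> (- m3)) [m1, m2] =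
          of_real (ladder_coeff J (m3 + 1)) * \<Phi> (- (m3 + 1)) [m1, m2]"
      using c\<Phi>[unfolded sq(1,2), unfolded sq(3,4)] by (simp_all add: unit_vector_def)
    define s where "s = complex_of_real ((-1) powi \<lfloor>j1 - j2 - m3\<rfloor> / sqrt (2 * J + 1))"
    \<comment> \<open>The minus signs of the adjacent slices let the third site cancel the joint
      action on the first two.\<close>
    have at': "?T [n1, n2, m3] = s * \<Phi> (- m3) [n1, n2]"
      "?T [n1, n2, m3 - 1] = - s * \<Phi> (- (m3 - 1)) [n1, n2]"
      "?T [n1, n2, m3 + 1] = - s * \<Phi> (- (m3 + 1)) [n1, n2]" for n1 n2
      unfolding at s_def floor_sign_shift by simp_all
    have "total_op spin_plus ?js ?T ms = of_real (ladder_coeff j1 m1) * ?T [m1 - 1, m2, m3] +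
        of_real (ladder_coeff j2 m2) * ?T [m1, m2 - 1, m3] + of_real (ladder_coeff J m3) * ?T [m1, m2, m3 - 1]"
      unfolding ms using total_op_spin_plus[OF T b] by (simp add: lessThan_Suc ac_simps)
    also have "\<dots> = s * (total_op spin_plus [j1, j2] (\<Phi> (- m3)) [m1, m2] -
        of_real (ladder_coeff J m3) * \<Phi> (- (m3 - 1)) [m1, m2])"
      unfolding at' spin_plus_pair[OF \<Phi> b2] by (simp add: algebra_simps)
    finally have 1: "total_op spin_plus ?js ?T ms = 0" unfolding plus by simp
    have "total_op spin_minus ?js ?T ms = of_real (ladder_coeff j1 (m1 + 1)) * ?T [m1 + 1, m2, m3] +
        of_real (ladder_coeff j2 (m2 + 1)) * ?T [m1, m2 + 1, m3] +
        of_real (ladder_coeff J (m3 + 1)) * ?T [m1, m2, m3 + 1]"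
      unfolding ms using total_op_spin_minus[OF T b] by (simp add: lessThan_Suc ac_simps)
    also have "\<dots> = s * (total_op spin_minus [j1, j2] (\<Phi> (- m3)) [m1, m2] -
        of_real (ladder_coeff J (m3 + 1)) * \<Phi> (- (m3 + 1)) [m1, m2])"
      unfolding at' spin_minus_pair[OF \<Phi> b2] by (simp add: algebra_simps)
    finally have 2: "total_op spin_minus ?js ?T ms = 0" unfolding minus by simp
    have "of_real (m1 + m2 + m3) * \<Phi> (- m3) [m1, m2] = 0"
      using z unfolding total_op_spin_z[OF \<Phi>] by (simp add: distrib_right add.assoc[symmetric])
    then have 3: "total_op spin_z ?js ?T ms = 0"
      unfolding total_op_spin_z[OF T] ms at' by (auto simp: add.assoc)
    show ?thesis using 1 2 3 by blast
  next
    case False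
    then show ?thesis
      using total_op_tensor_space[of _ ?js ?T] by (simp add: tensor_space_iff)
  qed
  then show ?thesis using T by (auto simp: invariant_space_iff fun_eq_iff)
qed

lemma coupled_triple_top:
  assumes t: "triad j1 j2 J" and c: "coupled_basis j1 j2 J \<Phi>"
  shows "coupled_triple j1 j2 J \<Phi> [j1, J - j1, - J] \<noteq> 0"
proof -
  have "0 \<le> J" using t spin_dim_eq(2) by (auto simp: triad_def)
  moreover have "\<Phi> J [j1, J - j1] \<noteq> 0" using c by (auto simp: coupled_basis_def)
  ultimately show ?thesis by (simp add: coupled_triple_at[OF t c])
qed

text \<open>Subtracting the multiple that matches the starting coordinate leaves an invariant vector
  with that coordinate zero, hence zero.\<close>

lemma coupled_triple_spans:
  assumes t: "triad j1 j2 J" and c: "coupled_basis j1 j2 J \<Phi>"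
    and \<psi>: "\<psi> \<in> invariant_space [j1, j2, J]"
  shows "\<psi> = cscale (\<psi> [j1, J - j1, - J] / coupled_triple j1 j2 J \<Phi> [j1, J - j1, - J])
    (coupled_triple j1 j2 J \<Phi>)"
proof -
  let ?T = "coupled_triple j1 j2 J \<Phi>" and ?x = "[j1, J - j1, - J]"
  let ?\<delta> = "\<psi> + cscale (- (\<psi> ?x / ?T ?x)) ?T"
  have j: "j1 \<in> spins" "j2 \<in> spins" "J \<in> spins" using t by (auto simp: triad_def)
  have "?\<delta> \<in> invariant_space [j1, j2, J]"
    by (intro states.subspace_add states.subspace_scale subspace_invariant_space \<psi>
        coupled_triple_invariant[OF t c])
  moreover have "?\<delta> ?x = 0" using coupled_triple_top[OF t c] by simp
  ultimately have "?\<delta> = 0" by (rule invariant3_eq_zero[OF j])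
  then have "\<psi> = - cscale (- (\<psi> ?x / ?T ?x)) ?T" by (rule eq_neg_iff_add_eq_0[THEN iffD2])
  also have "\<dots> = cscale (\<psi> ?x / ?T ?x) ?T" by (simp add: states.scale_minus_left)
  finally show ?thesis .
qed

text \<open>The triples of both bases lie on one line, so a single factor q relates all members at
  once. The phase convention makes q positive and normalisation gives |q| = 1.\<close>

lemma coupled_basis_unique:
  assumes t: "triad j1 j2 J" and c: "coupled_basis j1 j2 J \<Phi>" and c': "coupled_basis j1 j2 J \<Phi>'"
  shows "\<Phi>' = \<Phi>"
proof -
  have J: "J \<in> spins" "0 \<le> J" using t spin_dim_eq(2) by (auto simp: triad_def)
  let ?T = "coupled_triple j1 j2 J \<Phi>" and ?T' = "coupled_triple j1 j2 J \<Phi>'" and ?x = "[j1, J - j1, - J]"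
  obtain q where q: "?T' = cscale q ?T"
    using coupled_triple_spans[OF t c coupled_triple_invariant[OF t c']] by blast
  have eq: "\<Phi>' M = cscale q (\<Phi> M)" for M
  proof (cases "M \<in> set (weights J)")
    case True
    then have ts: "\<Phi> M \<in> tensor_space [j1, j2]" "\<Phi>' M \<in> tensor_space [j1, j2]"
      using c c' by (auto simp: coupled_basis_def unit_vector_def)
    have "\<Phi>' M ms = q * \<Phi> M ms" for ms
    proof (cases "ms \<in> set (basis [j1, j2])")
      case True
      then obtain m1 m2 where "ms = [m1, m2]" by (rule basis2E)
      moreover have "?T' [m1, m2, - M] = q * ?T [m1, m2, - M]" by (simp add: q)
      ultimately show ?thesis
        using J by (simp add: coupled_triple_at[OF t c] coupled_triple_at[OF t c'])
    qed (use ts in \<open>simp add: tensor_space_iff\<close>)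
    then show ?thesis by (simp add: fun_eq_iff)
  qed (use c c' in \<open>simp add: coupled_basis_def\<close>)
  have "q = 1"
  proof -
    let ?p = "\<Phi> J [j1, J - j1]" and ?p' = "\<Phi>' J [j1, J - j1]"
    have pp: "?p' = q * ?p" by (simp add: eq)
    have "?p \<in> \<real>" "0 < Re ?p" "?p' \<in> \<real>" "0 < Re ?p'" using c c' by (auto simp: coupled_basis_def)
    then obtain r r' where r: "?p = of_real r" "?p' = of_real r'" "0 < r" "0 < r'"
      by (auto elim!: Reals_cases)
    then have "q = of_real r' / of_real r" using pp by (simp add: field_simps)
    then have qr: "q = of_real (r' / r)" "0 < r' / r" using r by simp_all
    have "J \<in> set (weights J)" by (rule weights_extreme[OF J(1)])
    then have "state_inner [j1, j2] (\<Phi> J) (\<Phi> J) = 1" "state_inner [j1, j2] (\<Phi>' J) (\<Phi>' J) = 1"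
      using c c' by (auto simp: coupled_basis_def unit_vector_iff)
    then have "q * cnj q = 1" by (simp add: eq state_inner_cscale mult.commute)
    then have "(r' / r)\<^sup>2 = 1"
      unfolding qr(1) complex_cnj_complex_of_real of_real_mult[symmetric] of_real_eq_1_iff
      by (simp only: power2_eq_square)
    then have "r' / r = 1 \<or> r' / r = - 1" by (simp only: power2_eq_1_iff)
    with qr(2) have "r' / r = 1" by linarith
    then show ?thesis using qr(1) by simp
  qed
  then show ?thesis using eq by (simp add: fun_eq_iff)
qed

section \<open>Identifying the three-j state and its norm\<close>

lemma sum_state_apply: "(\<Sum>a\<in>A. F a) ms = (\<Sum>a\<in>A. F a ms)" for F :: "'a \<Rightarrow> state"
  by (induction A rule: infinite_finite_induct) auto

lemma three_j_state_at:
  "three_j_state j1 j2 j3 ms = (if ms \<in> set (basis [j1, j2, j3])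
     then of_real (wigner_3j j1 j2 j3 (ms ! 0) (ms ! 1) (ms ! 2)) else 0)"
proof (cases "ms \<in> set (basis [j1, j2, j3])")
  case True
  then obtain a b c where ms: "ms = [a, b, c]" and m: "a \<in> set (weights j1)"
      "b \<in> set (weights j2)" "c \<in> set (weights j3)"
    by (rule basis3E)
  let ?w = "\<lambda>m1 m2 m3. complex_of_real (wigner_3j j1 j2 j3 m1 m2 m3)"
  have 1: "(\<Sum>m3\<in>set (weights j3). ?w m1 m2 m3 * ket [m1, m2, m3] ms) =
      (if m2 = b then if m1 = a then ?w m1 m2 c else 0 else 0)" for m1 m2
  proof -
    have "(\<Sum>m3\<in>set (weights j3). ?w m1 m2 m3 * ket [m1, m2, m3] ms) =
        (\<Sum>m3\<in>set (weights j3). if m3 = c then (if m2 = b then if m1 = a then ?w m1 m2 c else 0 else 0) else 0)"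
      by (intro sum.cong) (auto simp: ket_def ms)
    then show ?thesis using m(3) by simp
  qed
  have "three_j_state j1 j2 j3 ms = (\<Sum>m1\<in>set (weights j1). \<Sum>m2\<in>set (weights j2).
      if m2 = b then if m1 = a then ?w m1 m2 c else 0 else 0)"
    unfolding three_j_state_def sum_state_apply cscale_simps 1 ..
  also have "\<dots> = ?w a b c" using m by simp
  finally show ?thesis using True ms by simp
next
  case False
  then have "ket [m1, m2, m3] ms = 0"
    if "m1 \<in> set (weights j1)" "m2 \<in> set (weights j2)" "m3 \<in> set (weights j3)" for m1 m2 m3
    using that by (auto simp: ket_def basis3_iff)
  then show ?thesis using False by (simp add: three_j_state_def sum_state_apply)
qed

text \<open>Uniqueness evaluates the \<open>THE\<close> in \<open>clebsch_gordan\<close>, and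
  reality of the coordinates removes its \<open>Re\<close>.\<close>

lemma three_j_state_eq_coupled_triple:
  assumes t: "triad j1 j2 J"
  obtains \<Phi> where "coupled_basis j1 j2 J \<Phi>" "three_j_state j1 j2 J = coupled_triple j1 j2 J \<Phi>"
proof -
  obtain \<Phi> where c: "coupled_basis j1 j2 J \<Phi>" and real: "\<And>M ms. \<Phi> M ms \<in> \<real>"
    using ex_coupled_basis[OF t] by blast
  have "(THE \<Phi>. coupled_basis j1 j2 J \<Phi>) = \<Phi>"
    using c coupled_basis_unique[OF t c] by (rule the_equality)
  then have "three_j_state j1 j2 J = coupled_triple j1 j2 J \<Phi>"
    using t real
    by (auto simp: fun_eq_iff three_j_state_at coupled_triple_def wigner_3j_def clebsch_gordan_def)
  with c that show thesis by blast
qed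

lemma sum_basis3:
  "(\<Sum>ms\<in>set (basis [j1, j2, j3]). f ms) =
    (\<Sum>m3\<in>set (weights j3). \<Sum>ms\<in>set (basis [j1, j2]). f (ms @ [m3]))"
  unfolding sum.cartesian_product
  by (rule sum.reindex_bij_witness[where i = "\<lambda>(m3, ms). ms @ [m3]"
        and j = "\<lambda>ms. (ms ! 2, [ms ! 0, ms ! 1])"])
    (auto elim!: basis2E basis3E simp: basis2_iff basis3_iff)

text \<open>Each of the 2 J + 1 slices at fixed m3 is a unit vector scaled by 1 / sqrt (2 J + 1), up
  to sign; this is the origin of that factor in the three-j symbol.\<close>

lemma coupled_triple_unit:
  assumes t: "triad j1 j2 J" and c: "coupled_basis j1 j2 J \<Phi>"
  shows "unit_vector [j1, j2, J] (coupled_triple j1 j2 J \<Phi>)"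
proof -
  let ?T = "coupled_triple j1 j2 J \<Phi>"
  have J: "J \<in> spins" using t by (simp add: triad_def)
  have "(\<Sum>ms\<in>set (basis [j1, j2]). (cmod (?T (ms @ [m])))\<^sup>2) = 1 / (2 * J + 1)"
    if "m \<in> set (weights J)" for m
  proof -
    have "(\<Sum>ms\<in>set (basis [j1, j2]). (cmod (?T (ms @ [m])))\<^sup>2) =
        (\<Sum>ms\<in>set (basis [j1, j2]). (cmod (\<Phi> (- m) ms))\<^sup>2 / (2 * J + 1))"
      using spin_dim_eq(2)[OF J]
      by (intro sum.cong refl, elim basis2E)
        (simp add: coupled_triple_at[OF t c] norm_mult norm_divide norm_power_int power_mult_distrib power_divide)
    also have "\<dots> = 1 / (2 * J + 1)"
      using c weights_uminus[OF J that]
      by (simp add: coupled_basis_def unit_vector_def flip: sum_divide_distrib)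
    finally show ?thesis .
  qed
  then have "(\<Sum>ms\<in>set (basis [j1, j2, J]). (cmod (?T ms))\<^sup>2) = real (spin_dim J) / (2 * J + 1)"
    unfolding sum_basis3 by (simp add: distinct_card[OF distinct_weights] length_weights)
  also have "\<dots> = 1" using spin_dim_eq[OF J] by simp
  finally show ?thesis
    unfolding unit_vector_def by (simp add: tensor_space_iff coupled_triple_def)
qed

lemma three_j_state_facts:
  assumes t: "triad j1 j2 j3"
  shows "three_j_state j1 j2 j3 \<in> invariant_space [j1, j2, j3]"
    and "unit_vector [j1, j2, j3] (three_j_state j1 j2 j3)"
    and "\<psi> \<in> invariant_space [j1, j2, j3] \<Longrightarrow> \<exists>c. \<psi> = cscale c (three_j_state j1 j2 j3)"
    and "three_j_state j1 j2 j3 \<noteq> 0"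
proof -
  obtain \<Phi> where c: "coupled_basis j1 j2 j3 \<Phi>" and eq: "three_j_state j1 j2 j3 = coupled_triple j1 j2 j3 \<Phi>"
    using three_j_state_eq_coupled_triple[OF t] .
  show "three_j_state j1 j2 j3 \<in> invariant_space [j1, j2, j3]"
    "unit_vector [j1, j2, j3] (three_j_state j1 j2 j3)"
    "\<psi> \<in> invariant_space [j1, j2, j3] \<Longrightarrow> \<exists>c. \<psi> = cscale c (three_j_state j1 j2 j3)"
    unfolding eq using coupled_triple_invariant[OF t c] coupled_triple_unit[OF t c] coupled_triple_spans[OF t c]
    by blast+
  show "three_j_state j1 j2 j3 \<noteq> 0"
    unfolding eq using coupled_triple_top[OF t c] by auto
qed

lemma dim_span_singleton: "\<psi> \<noteq> 0 \<Longrightarrow> states.dim (states.span {\<psi>}) = 1"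
  using states.dim_eq_card_independent[of "{\<psi>}"] by (simp add: states.independent_insert)

section \<open>Three equal spins\<close>

lemma invariant_perfect_3_iff:
  assumes j: "j \<in> spins"
  shows "invariant_perfect j 3 \<psi> \<longleftrightarrow> \<psi> \<in> invariant_space [j, j, j] \<and> unit_vector [j, j, j] \<psi>"
proof -
  have r: "replicate 3 j = [j, j, j]" by (simp add: numeral_3_eq_3)
  have "reduced_density [j, j, j] A \<psi> = 1 / of_nat (spin_dim j ^ card A) \<cdot>\<^sub>m 1\<^sub>m (spin_dim j ^ card A)"
    if \<psi>: "\<psi> \<in> invariant_space [j, j, j]" "unit_vector [j, j, j] \<psi>"
      and A: "A \<subseteq> {..<3}" "1 \<le> card A" "card A \<le> 3 div 2" for A
  proof -
    \<comment> \<open>As 3 div 2 = 1, perfection tests single sites only, and these are maximally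
      mixed by invariance.\<close>
    have "card A = 1" using A by simp
    then obtain k where k: "A = {k}" by (rule card_1_singletonE)
    then have "k < length [j, j, j]" "[j, j, j] ! k = j"
      using A(1) by (auto simp: less_Suc_eq numeral_3_eq_3)
    moreover have "of_real (1 / (2 * j + 1)) = (1 / of_nat (spin_dim j) :: complex)"
      unfolding spin_dim_eq(1)[OF j, symmetric] by simp
    ultimately show ?thesis
      using reduced_density_invariant[of "[j, j, j]", OF _ \<psi>, of k] j k by simp
  qed
  then show ?thesis unfolding invariant_perfect_def perfect_def r by blast
qed

lemma unit_vector_cscale_iff:
  assumes "unit_vector js \<psi>"
  shows "unit_vector js (cscale c \<psi>) \<longleftrightarrow> cmod c = 1"
proof -
  have "unit_vector js (cscale c \<psi>) \<longleftrightarrow> (cmod c)\<^sup>2 = 1"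
    using assms unfolding unit_vector_def
    by (simp add: tensor_space_cscale norm_mult power_mult_distrib flip: sum_distrib_left)
  then show ?thesis using norm_ge_zero[of c] by (auto simp: power2_eq_1_iff)
qed

text \<open>Odd 2 j + 1 means integer j, so that (j, j, j) is a triad. On the resulting line of
  invariants, unit vectors differ by a factor of modulus 1, which is some
  \<open>cis \<theta>\<close>.\<close>

lemma invariant_perfect_3_odd:
  assumes j: "j \<in> spins" and odd: "odd (spin_dim j)"
  shows "{\<psi>. invariant_perfect j 3 \<psi>} = {cscale (cis \<theta>) (three_j_state j j j) | \<theta>. True}"
proof -
  obtain n where n: "2 * j = real n" using j by (auto simp: spins_def elim: Nats_cases)
  then have "real (spin_dim j) = real (n + 1)" using spin_dim_eq(1)[OF j] by simp
  then have "spin_dim j = n + 1" by (simp only: of_nat_eq_iff)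
  with odd obtain m where "n = 2 * m" by auto
  then have "j = real m" using n by simp
  then have t: "triad j j j" using j by (simp add: triad_def)
  note facts = three_j_state_facts[OF t]
  have phase: "(\<exists>\<theta>. c = cis \<theta>) \<longleftrightarrow> cmod c = 1" for c
    by (metis norm_cis rcis_cmod_Arg rcis_def mult_1 of_real_1)
  have "invariant_perfect j 3 \<psi> \<longleftrightarrow> (\<exists>\<theta>. \<psi> = cscale (cis \<theta>) (three_j_state j j j))" for \<psi>
  proof
    assume "invariant_perfect j 3 \<psi>"
    then show "\<exists>\<theta>. \<psi> = cscale (cis \<theta>) (three_j_state j j j)"
      using facts(2,3) phase unfolding invariant_perfect_3_iff[OF j] by (metis unit_vector_cscale_iff)
  next
    assume "\<exists>\<theta>. \<psi> = cscale (cis \<theta>) (three_j_state j j j)"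
    then show "invariant_perfect j 3 \<psi>"
      using facts(1,2) states.subspace_scale[OF subspace_invariant_space]
      unfolding invariant_perfect_3_iff[OF j] by (auto simp: unit_vector_cscale_iff)
  qed
  then show ?thesis by auto
qed

text \<open>A nonzero coordinate has total weight zero. With m_i = - j + n_i this reads n1 + n2 + n3
  = 3 j, so 2 (n1 + n2 + n3) + 3 = 3 (2 j + 1) would be both odd and even.\<close>

lemma invariant_space_even:
  assumes j: "j \<in> spins" and even: "even (spin_dim j)"
  shows "invariant_space [j, j, j] = {0}"
proof -
  have "\<psi> ms = 0" if \<psi>: "\<psi> \<in> invariant_space [j, j, j]" for \<psi> ms
  proof (rule ccontr)
    assume nz: "\<psi> ms \<noteq> 0"
    then have "ms \<in> set (basis [j, j, j])" using \<psi> by (auto simp: invariant_space_iff tensor_space_iff)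
    then obtain m1 m2 m3 where ms: "ms = [m1, m2, m3]" and m: "m1 \<in> set (weights j)"
      "m2 \<in> set (weights j)" "m3 \<in> set (weights j)"
      by (rule basis3E)
    obtain n1 n2 n3 :: nat where "m1 = - j + n1" "m2 = - j + n2" "m3 = - j + n3"
      using m by (metis weights_from_bottom)
    then have "real n1 + real n2 + real n3 = 3 * j"
      using invariant_weight_zero[OF \<psi> nz] ms by simp
    then have "real (2 * (n1 + n2 + n3) + 3) = real (3 * spin_dim j)"
      using spin_dim_eq(1)[OF j] by simp
    then have "2 * (n1 + n2 + n3) + 3 = 3 * spin_dim j" by (simp only: of_nat_eq_iff)
    then have "even (2 * (n1 + n2 + n3) + 3)" using even by simp
    then show False by simp
  qed
  moreover have "0 \<in> invariant_space [j, j, j]"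
    by (rule states.subspace_0[OF subspace_invariant_space])
  ultimately show ?thesis by (auto simp: fun_eq_iff)
qed

theorem mainTheorem2:
  shows "(\<forall>j1 j2 j3 :: real.
      j1 \<in> spins \<and> j2 \<in> spins \<and> j3 \<in> spins \<and>
      \<bar>j1 - j2\<bar> \<le> j3 \<and> j3 \<le> j1 + j2 \<and> j1 + j2 + j3 \<in> \<int> \<longrightarrow>
        module.subspace cscale (invariant_space [j1, j2, j3]) \<and>
        vector_space.dim cscale (invariant_space [j1, j2, j3]) = 1 \<and>
        invariant_space [j1, j2, j3] = module.span cscale {three_j_state j1 j2 j3} \<and>
        unit_vector [j1, j2, j3] (three_j_state j1 j2 j3) \<and>
        (\<forall>k<3. let jk = [j1, j2, j3] ! k;
                   \<rho> = reduced_density [j1, j2, j3] {k} (three_j_state j1 j2 j3)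
               in \<rho> = of_real (1 / (2 * jk + 1)) \<cdot>\<^sub>m 1\<^sub>m (spin_dim jk) \<and>
                  von_neumann_entropy \<rho> = ln (2 * jk + 1) \<and>
                  (\<forall>\<sigma> \<in> density_matrices (spin_dim jk).
                     von_neumann_entropy \<sigma> \<le> ln (2 * jk + 1))))
    \<and> (\<forall>j \<in> spins.
        (odd (spin_dim j) \<longrightarrow>
           {\<psi>. invariant_perfect j 3 \<psi>} =
             {cscale (cis \<theta>) (three_j_state j j j) | \<theta>. True}) \<and>
        (even (spin_dim j) \<longrightarrow> invariant_space [j, j, j] = {0}))"
proof (intro conjI allI impI ballI; (elim conjE)?)
  fix j1 j2 j3 :: real
  assume j: "j1 \<in> spins" "j2 \<in> spins" "j3 \<in> spins"
    and "\<bar>j1 - j2\<bar> \<le> j3" "j3 \<le> j1 + j2" "j1 + j2 + j3 \<in> \<int>"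
  then have t: "triad j1 j2 j3" by (simp add: triad_def)
  note facts = three_j_state_facts[OF t]
  show "module.subspace cscale (invariant_space [j1, j2, j3])"
    by (rule subspace_invariant_space)
  show span: "invariant_space [j1, j2, j3] = module.span cscale {three_j_state j1 j2 j3}"
  proof
    show "invariant_space [j1, j2, j3] \<subseteq> states.span {three_j_state j1 j2 j3}"
      using facts(3) by (auto simp: states.span_singleton)
    show "states.span {three_j_state j1 j2 j3} \<subseteq> invariant_space [j1, j2, j3]"
      by (intro states.span_minimal subspace_invariant_space) (use facts(1) in simp)
  qed
  show "vector_space.dim cscale (invariant_space [j1, j2, j3]) = 1"
    unfolding span using facts(4) by (rule dim_span_singleton)
  show "unit_vector [j1, j2, j3] (three_j_state j1 j2 j3)" by (rule facts(2))
  fix k :: nat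
  assume k: "k < 3"
  define jk where "jk = [j1, j2, j3] ! k"
  have jk: "jk \<in> spins" using k j by (auto simp: jk_def less_Suc_eq numeral_3_eq_3)
  note d = spin_dim_eq(1,3)[OF jk]
  have "reduced_density [j1, j2, j3] {k} (three_j_state j1 j2 j3) =
      of_real (1 / (2 * jk + 1)) \<cdot>\<^sub>m 1\<^sub>m (spin_dim jk)"
    unfolding jk_def using facts(1,2) j k by (intro reduced_density_invariant) auto
  then show "let jk = [j1, j2, j3] ! k;
          \<rho> = reduced_density [j1, j2, j3] {k} (three_j_state j1 j2 j3)
        in \<rho> = of_real (1 / (2 * jk + 1)) \<cdot>\<^sub>m 1\<^sub>m (spin_dim jk) \<and>
          von_neumann_entropy \<rho> = ln (2 * jk + 1) \<and>
          (\<forall>\<sigma> \<in> density_matrices (spin_dim jk). von_neumann_entropy \<sigma> \<le> ln (2 * jk + 1))"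
    using von_neumann_entropy_maximally_mixed[OF d(2)] von_neumann_entropy_le[OF _ d(2)]
    unfolding Let_def jk_def[symmetric] d(1) by simp
qed (simp_all add: invariant_perfect_3_odd invariant_space_even)

end
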